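(* Let $K$ be a compact generic Cauchy-Riemann nondegenerate $\mathcal{C}^5$ piecewise-smooth submanifold in $\mathbb{C}^n$. Let $\mu$ be a finite measure supported on $K$ such that there exist constants $\tau>0$, $r_0>0$ satisfying $\mu(\mathbb{B}(z,r)\cap K)\ge r^\tau$ for every $z\in K$ and every $0<r\le r_0$, where $\mathbb{B}(z,r)$ denotes the ball of radius $r$ centered at $z$ in $\mathbb{C}^n$. Then for every continuous function $Q: K\to\mathbb{R}$, $\mu$ is a Bernstein-Markov measure with respect to $(K,Q)$.
   Context: A (convex) polyhedron in $\mathbb{R}^N$ is the intersection of a finite number of closed half-spaces. A subset $K$ of a real $N$-dimensional smooth manifold $Y$ is called a nondegenerate $\mathcal{C}^5$ piecewise-smooth submanifold of dimension $m$ if for every $p\in K$ there is a local chart $(W_p,\Psi)$ of $Y$ around $p$ such that $\Psi$ is a $\mathcal{C}^5$-diffeomorphism from $W_p$ to the unit ball of $\mathbb{R}^N$ and $\Psi(K\cap W_p)$ is the intersection with the unit ball of a finite union of convex polyhedra of the same dimension $m$. A point $p\in K$ is regular if the chart can be chosen such that $\Psi(K\cap W_p)$ is the intersection of the unit ball with an $m$-dimensional vector subspace of $\mathbb{R}^N$. Here $\mathbb{C}^n$ is regarded as a real $2n$-dimensional manifold with complex structure $J$ on its tangent spaces. $K\subset\mathbb{C}^n$ is (Cauchy-Riemann) generic if for every $p\in K$ and every sequence of regular points $(p_m)_m\subset K$ converging to $p$, any limit $E$ of the tangent spaces $T_{p_m}K$ satisfies $E+JE=T_p\mathbb{C}^n$.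 $\mathcal{P}_k$ is the space of restrictions to $K$ of complex polynomials of degree at most $k$ on $\mathbb{C}^n$, and $\|s\|^2_{L^2(\mu,kQ)}=\int_K|s|^2e^{-2kQ}\,d\mu$. The measure $\mu$ is Bernstein-Markov with respect to $(K,Q)$ if for every $\epsilon>0$ there exists $C>0$ (independent of $k$ and $s$) such that $\sup_K|s|^2e^{-2kQ}\le Ce^{\epsilon k}\|s\|^2_{L^2(\mu,kQ)}$ for every $k$ and every $s\in\mathcal{P}_k$. *)

theory Defs
  imports "HOL-Analysis.Analysis"
begin

text \<open>
  \<open>C\<^sup>k\<close> regularity on a set \<open>S\<close>, used only for open \<open>S\<close>. In finite dimensions it suffices that
  all iterated directional derivatives exist as Frechet derivatives and are continuous.
\<close>

primrec Ck_on :: "nat \<Rightarrow> 'a::euclidean_space set \<Rightarrow> ('a \<Rightarrow> 'b::euclidean_space) \<Rightarrow> bool" where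
  "Ck_on 0 S f \<longleftrightarrow> continuous_on S f"
| "Ck_on (Suc k) S f \<longleftrightarrow>
     (\<forall>x\<in>S. f differentiable (at x)) \<and> (\<forall>v. Ck_on k S (\<lambda>x. frechet_derivative f (at x) v))"

definition Ck_diffeomorphism ::
    "nat \<Rightarrow> 'a::euclidean_space set \<Rightarrow> 'b::euclidean_space set \<Rightarrow> ('a \<Rightarrow> 'b) \<Rightarrow> bool" where
  "Ck_diffeomorphism k U V f \<longleftrightarrow>
     open U \<and> open V \<and> bij_betw f U V \<and> Ck_on k U f \<and> Ck_on k V (inv_into U f)"

text \<open>
  The ambient manifold is the Euclidean space \<open>'a\<close> of dimension \<open>N = DIM('a)\<close>. The model space
  \<open>\<real>\<^sup>N\<close> of the charts is \<open>'a\<close> itself, which is linearly isometric to \<open>\<real>\<^sup>N\<close>. As usual, the chart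
  need not send \<open>p\<close> to the origin.
\<close>

definition unit_ball_chart_at :: "nat \<Rightarrow> 'a::euclidean_space \<Rightarrow> 'a set \<Rightarrow> ('a \<Rightarrow> 'a) \<Rightarrow> bool" where
  "unit_ball_chart_at k p W \<Psi> \<longleftrightarrow> p \<in> W \<and> Ck_diffeomorphism k W (ball 0 1) \<Psi>"

definition nondegenerate_piecewise_smooth :: "nat \<Rightarrow> nat \<Rightarrow> 'a::euclidean_space set \<Rightarrow> bool" where
  "nondegenerate_piecewise_smooth k m K \<longleftrightarrow>
     (\<forall>p\<in>K. \<exists>W \<Psi>. unit_ball_chart_at k p W \<Psi> \<and>
        (\<exists>F. finite F \<and> (\<forall>P\<in>F. polyhedron P \<and> aff_dim P = int m) \<and>
             \<Psi> ` (K \<inter> W) = ball 0 1 \<inter> \<Union>F))"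

definition regular_point :: "nat \<Rightarrow> nat \<Rightarrow> 'a::euclidean_space set \<Rightarrow> 'a \<Rightarrow> bool" where
  "regular_point k m K p \<longleftrightarrow>
     p \<in> K \<and>
     (\<exists>W \<Psi> V. unit_ball_chart_at k p W \<Psi> \<and> subspace V \<and> dim V = m \<and>
        \<Psi> ` (K \<inter> W) = ball 0 1 \<inter> V)"

text \<open>
  Velocities of curves in \<open>K\<close> through \<open>p\<close>. At a regular point this is the usual tangent space, the
  preimage under the derivative of \<open>\<Psi>\<close> at \<open>p\<close> of the subspace \<open>V\<close> in any chart as above.
\<close>

definition tangent_space :: "'a::euclidean_space set \<Rightarrow> 'a \<Rightarrow> 'a set" where
  "tangent_space K p =
     {v. \<exists>\<gamma> e. e > 0 \<and> (\<forall>t\<in>{-e<..<e}. \<gamma> t \<in> K) \<and> \<gamma> 0 = p \<and>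
           (\<gamma> has_vector_derivative v) (at (0::real))}"

text \<open>
  Convergence in the Grassmannian for the metric \<open>\<parallel>P\<^sub>E - P\<^sub>F\<parallel>\<close>, where \<open>P\<^sub>E\<close> is the orthogonal
  projection onto the linear subspace \<open>E\<close>, that is \<open>closest_point E\<close>. Small distance forces equal
  dimensions, so the limit has the dimension of the (eventual) terms of the sequence.
\<close>

definition subspaces_tendsto :: "(nat \<Rightarrow> 'a::euclidean_space set) \<Rightarrow> 'a set \<Rightarrow> bool" where
  "subspaces_tendsto T E \<longleftrightarrow>
     subspace E \<and> (\<forall>j. subspace (T j)) \<and>
     (\<lambda>j. onorm (\<lambda>x. closest_point (T j) x - closest_point E x)) \<longlonglongrightarrow> 0"

definition complex_structure :: "complex ^ 'n \<Rightarrow> complex ^ 'n" where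
  "complex_structure v = \<i> *s v"

text \<open>
  Subsequential limits of tangent spaces are covered too, since a subsequence of \<open>q\<close> is again an
  admissible sequence. The sum of \<open>E\<close> and its image is the sum of sets of \<open>Set_Algebras\<close>.
\<close>

definition CR_generic :: "nat \<Rightarrow> nat \<Rightarrow> (complex ^ 'n) set \<Rightarrow> bool" where
  "CR_generic k m K \<longleftrightarrow>
     (\<forall>p\<in>K. \<forall>q E. (\<forall>j. regular_point k m K (q j)) \<longrightarrow> q \<longlonglongrightarrow> p \<longrightarrow>
        subspaces_tendsto (\<lambda>j. tangent_space K (q j)) E \<longrightarrow>
        E + complex_structure ` E = UNIV)"

definition complex_polynomials :: "nat \<Rightarrow> (complex ^ 'n \<Rightarrow> complex) set" where
  "complex_polynomials k =
     {(\<lambda>z. \<Sum>\<alpha> | (\<Sum>i\<in>UNIV. \<alpha> i) \<le> k. c \<alpha> * (\<Prod>i\<in>UNIV. (z $ i) ^ \<alpha> i)) |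
        c :: ('n \<Rightarrow> nat) \<Rightarrow> complex. True}"

definition polynomials_on :: "nat \<Rightarrow> (complex ^ 'n) set \<Rightarrow> (complex ^ 'n \<Rightarrow> complex) set" where
  "polynomials_on k K = (\<lambda>p. restrict p K) ` complex_polynomials k"

definition weighted_L2_norm_sq ::
    "(complex ^ 'n) measure \<Rightarrow> (complex ^ 'n) set \<Rightarrow> (complex ^ 'n \<Rightarrow> real) \<Rightarrow> nat \<Rightarrow>
     (complex ^ 'n \<Rightarrow> complex) \<Rightarrow> ennreal" where
  "weighted_L2_norm_sq \<mu> K Q k s =
     (\<integral>\<^sup>+z\<in>K. ennreal ((cmod (s z))\<^sup>2 * exp (- 2 * real k * Q z)) \<partial>\<mu>)"

text \<open>
  The inequality is stated in \<open>ennreal\<close>, so that the supremum needs no boundedness or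
  nonemptiness assumption and the integral no integrability assumption.
\<close>

definition bernstein_markov ::
    "(complex ^ 'n) measure \<Rightarrow> (complex ^ 'n) set \<Rightarrow> (complex ^ 'n \<Rightarrow> real) \<Rightarrow> bool" where
  "bernstein_markov \<mu> K Q \<longleftrightarrow>
     (\<forall>\<epsilon>>0. \<exists>C>0. \<forall>k. \<forall>s\<in>polynomials_on k K.
        (SUP z\<in>K. ennreal ((cmod (s z))\<^sup>2 * exp (- 2 * real k * Q z)))
          \<le> ennreal (C * exp (\<epsilon> * real k)) * weighted_L2_norm_sq \<mu> K Q k s)"

end

theory Submission
  imports Defs "HOL-Complex_Analysis.Conformal_Mappings"
begin

text \<open>
  The Bernstein-Markov property rests on a local estimate at a point \<open>z\<^sub>0\<close> of \<open>K\<close>: a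
  polynomial \<open>s\<close> of degree at most \<open>k\<close> with \<open>\<bar>s\<bar> \<le> M\<close> on \<open>K\<close> near \<open>z\<^sub>0\<close> satisfies \<open>\<bar>s\<bar> \<le> 4 M\<close> on a full ball
  in \<open>\<complex>\<^sup>n\<close> around \<open>z\<^sub>0\<close> of radius \<open>c / k ^ 4\<close>, where \<open>c\<close> depends neither on \<open>s\<close> nor on \<open>k\<close> nor on \<open>z\<^sub>0\<close>
  (\<open>tube_bounded_uniform\<close>). Given this, take for \<open>z\<^sub>0\<close> a maximum point of the weighted polynomial.
  Since the weight varies slowly, the estimate and the Schwarz lemma show that the polynomial keeps
  half of its size on a ball around \<open>z\<^sub>0\<close> whose radius decays in \<open>k\<close> at an exponential rate as small as
  desired, and the lower bound on the mass of balls turns this into the inequality between the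
  supremum and the \<open>L\<^sup>2\<close> norm
  (\<open>bernstein_markov_of_uniform_tube_bound\<close>).

  The local estimate comes from a self-improvement argument. Genericity provides, through every
  point of \<open>K\<close>, a \<open>C\<^sup>2\<close> image of a cube \<open>[0, a] ^ n\<close> with the point as a corner, whose
  partial derivatives are a basis of \<open>\<complex>\<^sup>n\<close> over \<open>\<complex>\<close>. For an affine cube of this kind with side \<open>\<rho>\<close>,
  Bernstein's inequality in each complex coordinate direction bounds the polynomial on a ball of
  radius comparable with \<open>\<rho> / k\<^sup>2\<close> (\<open>complex_polynomial_growth_near_corner\<close>). A curved cube differs
  from its tangent cube by \<open>O(\<rho>\<^sup>2)\<close>. So if the polynomial is under control in a tube of radius \<open>\<delta>\<close>
  around the curved cube, it is under control on tangent cubes of side comparable with the square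
  root of \<open>\<delta>\<close>, hence in a tube of radius comparable with the square root of \<open>\<delta>\<close> divided by \<open>k\<^sup>2\<close>
  (\<open>tube_enlargement\<close>). As long as \<open>\<delta>\<close> is small compared with \<open>1 / k ^ 4\<close>, this is an improvement, and
  the constants do not deteriorate. Starting from the thin tube that continuity provides, one
  arrives at a tube of radius \<open>c / k ^ 4\<close> (\<open>polynomial_bound_near_corner\<close>).

  To find the corners, fix a chart at \<open>p\<close> and a polyhedron \<open>P\<close> of the model that contains the image
  of \<open>p\<close>. Most points in the relative interior of \<open>P\<close> are regular, with tangent space the image of
  the direction of \<open>P\<close>, and these tangent spaces converge as the points tend to \<open>p\<close>. So genericity
  concerns precisely the image of the direction of \<open>P\<close> under the derivative of the inverse chart at
  \<open>p\<close> (\<open>generic_directions_of_polyhedron\<close>): it spans \<open>\<complex>\<^sup>n\<close> over \<open>\<complex>\<close>, and edges of simplices in \<open>P\<close> can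
  be chosen that become complex bases (\<open>tube_bounded_near_polyhedron\<close>).
\<close>

section \<open>Polynomials in one complex variable\<close>

text \<open>The two roots of the quadratic equation have product \<open>1\<close>, so one of them lies in the closed disc.\<close>

lemma Joukowsky_root:
  fixes u :: complex
  obtains w where "w \<noteq> 0" "cmod w \<le> 1" "(w - 1)\<^sup>2 = - u * w"
proof -
  define b where "b = 1 - u / 2"
  define e where "e = csqrt (b\<^sup>2 - 1)"
  have e2: "e\<^sup>2 = b\<^sup>2 - 1" by (simp add: e_def)
  have prod: "(b + e) * (b - e) = 1"
    using e2 by (simp add: algebra_simps power2_eq_square)
  have root: "(w - 1)\<^sup>2 = - u * w" if "w = b + e \<or> w = b - e" for w
  proof -
    have "(w - b)\<^sup>2 = b\<^sup>2 - 1" using that e2 by auto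
    then have "w\<^sup>2 - 2 * w * b + 1 = 0"
      by (simp add: power2_eq_square algebra_simps)
    then show ?thesis
      unfolding b_def by (simp add: algebra_simps power2_eq_square)
  qed
  have "cmod (b + e) * cmod (b - e) = 1"
    using prod by (metis norm_mult norm_one)
  then have "cmod (b + e) \<le> 1 \<or> cmod (b - e) \<le> 1"
    by (smt (verit) less_1_mult)
  moreover have "b + e \<noteq> 0" "b - e \<noteq> 0" using prod by auto
  ultimately show thesis using root that by blast
qed

text \<open>
  The map \<open>w \<mapsto> - (\<rho>/4) (w - 1)\<^sup>2 / w\<close> folds the unit circle onto the segment \<open>[0, \<rho>]\<close>. Multiplying
  the pullback of the polynomial by \<open>w ^ k\<close> removes the pole at the origin, so the maximum principle on
  the disc carries the bound on the segment to the bound \<open>M / \<bar>w\<bar> ^ k\<close>. A point at distance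
  \<open>\<rho> \<theta>\<^sup>2 / 4\<close> from the endpoint \<open>0\<close> comes from a \<open>w\<close> at distance \<open>\<theta>\<close> from \<open>1\<close>; this square root is
  what makes the admissible distance as large as \<open>\<rho> / k\<^sup>2\<close>.
\<close>

lemma polynomial_growth_near_endpoint:
  fixes p :: "complex poly" and \<rho> \<theta> M :: real
  assumes deg: "degree p \<le> k" and \<rho>: "\<rho> > 0"
    and M: "\<And>x. 0 \<le> x \<Longrightarrow> x \<le> \<rho> \<Longrightarrow> cmod (poly p (of_real x)) \<le> M"
    and \<theta>: "0 \<le> \<theta>" "\<theta> < 1" and z: "cmod z \<le> \<rho> * \<theta>\<^sup>2 / 4"
  shows "cmod (poly p z) * (1 - \<theta>) ^ k \<le> M"
proof -
  define F where
    "F w = (\<Sum>j\<le>k. coeff p j * (- of_real (\<rho>/4) * (w - 1)\<^sup>2) ^ j * w ^ (k - j))" for w :: complex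
  have F: "F w = w ^ k * poly p (- of_real (\<rho>/4) * (w - 1)\<^sup>2 / w)" if "w \<noteq> 0" for w
  proof -
    have "poly p x = (\<Sum>j\<le>k. coeff p j * x ^ j)" for x
    proof -
      have "(\<Sum>j\<le>k. coeff p j * x ^ j) = (\<Sum>j\<le>degree p. coeff p j * x ^ j)"
        by (rule sum.mono_neutral_right) (use deg in \<open>auto simp: coeff_eq_0\<close>)
      then show ?thesis by (simp add: poly_altdef)
    qed
    note poly_eq = this
    have "c * X ^ j * w ^ (k - j) = w ^ k * (c * (X / w) ^ j)" if "j \<in> {..k}" for c X :: complex and j
      using that \<open>w \<noteq> 0\<close> by (simp add: power_divide power_diff)
    then show ?thesis
      unfolding F_def poly_eq sum_distrib_left by (rule sum.cong[OF refl])
  qed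
  have circle: "cmod (F w) \<le> M" if "cmod w = 1" for w
  proof -
    have w0: "w \<noteq> 0" using that by auto
    have ww: "w * cnj w = 1"
      using that by (metis complex_norm_square of_real_1 one_power2)
    have "- of_real (\<rho>/4) * (w - 1)\<^sup>2 / w = - of_real (\<rho>/4) * (w + cnj w - 2)"
    proof -
      have "(w - 1)\<^sup>2 = w * (w + cnj w - 2)"
        using ww by (simp add: algebra_simps power2_eq_square)
      then show ?thesis using w0 by simp
    qed
    also have "\<dots> = of_real ((\<rho>/2) * (1 - Re w))"
      by (simp add: complex_eq_iff field_simps)
    finally have eq: "- of_real (\<rho>/4) * (w - 1)\<^sup>2 / w = of_real ((\<rho>/2) * (1 - Re w))" .
    have "\<bar>Re w\<bar> \<le> 1" using abs_Re_le_cmod[of w] that by simp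
    then have "0 \<le> (\<rho>/2) * (1 - Re w)" "(\<rho>/2) * (1 - Re w) \<le> (\<rho>/2) * 2"
      using \<rho> by (auto intro!: mult_nonneg_nonneg mult_left_mono)
    then have "0 \<le> (\<rho>/2) * (1 - Re w)" "(\<rho>/2) * (1 - Re w) \<le> \<rho>" by auto
    from M[OF this] show ?thesis
      by (simp only: F[OF w0] eq norm_mult norm_power that) simp
  qed
  have disc: "cmod (F w) \<le> M" if "cmod w \<le> 1" for w
  proof (rule maximum_modulus_frontier[of F "cball 0 1"])
    show "F holomorphic_on interior (cball 0 1)"
      unfolding F_def by (intro holomorphic_intros)
    show "continuous_on (closure (cball 0 1)) F"
      unfolding F_def by (intro continuous_intros)
  qed (use circle that in auto)
  obtain w where w: "w \<noteq> 0" "cmod w \<le> 1" "(w - 1)\<^sup>2 = - (4 * z / of_real \<rho>) * w"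
    by (rule Joukowsky_root)
  have "(cmod (w - 1))\<^sup>2 = 4 * cmod z / \<rho> * cmod w"
    using \<rho> by (simp add: norm_power[symmetric] w(3) norm_mult norm_divide)
  also have "\<dots> \<le> 4 * cmod z / \<rho> * 1"
    using w(2) \<rho> by (intro mult_left_mono) auto
  also have "\<dots> \<le> \<theta>\<^sup>2" using z \<rho> by (simp add: field_simps)
  finally have "cmod (w - 1) \<le> \<theta>"
    using \<theta>(1) by (rule power2_le_imp_le)
  then have lower: "1 - \<theta> \<le> cmod w"
    using norm_triangle_ineq2[of 1 "1 - w"] by (simp add: norm_minus_commute)
  have eq: "- of_real (\<rho>/4) * (w - 1)\<^sup>2 / w = z"
    using w(1) \<rho> by (simp add: w(3) field_simps)
  have "cmod (poly p z) * (1 - \<theta>) ^ k \<le> cmod (poly p z) * cmod w ^ k"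
    using lower \<theta> by (intro mult_left_mono power_mono) auto
  also have "\<dots> = cmod (F w)"
    by (simp only: F[OF w(1)] eq norm_mult norm_power) (rule mult.commute)
  also have "\<dots> \<le> M" by (rule disc[OF w(2)])
  finally show ?thesis .
qed

section \<open>Polynomials in several complex variables\<close>

lemma complex_polynomial_on_line:
  fixes s :: "complex ^ 'n \<Rightarrow> complex"
  assumes "s \<in> complex_polynomials k"
  obtains p where "degree p \<le> k" "\<And>\<zeta>. poly p \<zeta> = s (u + \<zeta> *s v)"
proof -
  obtain c where s: "s = (\<lambda>z. \<Sum>\<alpha> | (\<Sum>i\<in>UNIV. \<alpha> i) \<le> k. c \<alpha> * (\<Prod>i\<in>UNIV. (z $ i) ^ \<alpha> i))"
    using assms unfolding complex_polynomials_def by blast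
  let ?A = "{\<alpha> :: 'n \<Rightarrow> nat. (\<Sum>i\<in>UNIV. \<alpha> i) \<le> k}"
  define f where "f \<alpha> = smult (c \<alpha>) (\<Prod>i\<in>UNIV. [:u $ i, v $ i:] ^ \<alpha> i)" for \<alpha>
  have f: "degree (f \<alpha>) \<le> k" if "\<alpha> \<in> ?A" for \<alpha>
  proof -
    have "degree (f \<alpha>) \<le> degree (\<Prod>i\<in>UNIV. [:u $ i, v $ i:] ^ \<alpha> i)"
      unfolding f_def by (rule degree_smult_le)
    also have "\<dots> \<le> (\<Sum>i\<in>UNIV. degree ([:u $ i, v $ i:] ^ \<alpha> i))"
      using degree_prod_sum_le[of UNIV "\<lambda>i. [:u $ i, v $ i:] ^ \<alpha> i"] by (simp add: o_def)
    also have "\<dots> \<le> (\<Sum>i\<in>UNIV. \<alpha> i)"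
    proof (rule sum_mono)
      fix i
      have "degree ([:u $ i, v $ i:] ^ \<alpha> i) \<le> degree [:u $ i, v $ i:] * \<alpha> i"
        by (rule degree_power_le)
      also have "\<dots> \<le> 1 * \<alpha> i" by (intro mult_right_mono) auto
      finally show "degree ([:u $ i, v $ i:] ^ \<alpha> i) \<le> \<alpha> i" by simp
    qed
    finally show ?thesis using that by simp
  qed
  show thesis
  proof
    show "degree (\<Sum>\<alpha>\<in>?A. f \<alpha>) \<le> k"
      using f by (cases "finite ?A") (auto intro: degree_sum_le)
    show "poly (\<Sum>\<alpha>\<in>?A. f \<alpha>) \<zeta> = s (u + \<zeta> *s v)" for \<zeta>
      unfolding s f_def by (simp add: poly_sum poly_prod)
  qed
qed

lemma continuous_on_complex_polynomial:
  assumes "s \<in> complex_polynomials k"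
  shows "continuous_on S s"
  using assms unfolding complex_polynomials_def
  by (auto intro!: continuous_intros)

lemma complex_polynomials_mono:
  fixes s :: "complex ^ 'n \<Rightarrow> complex"
  assumes "s \<in> complex_polynomials k" "k \<le> l"
  shows "s \<in> complex_polynomials l"
proof -
  obtain c where s: "s = (\<lambda>z. \<Sum>\<alpha> | (\<Sum>i\<in>UNIV. \<alpha> i) \<le> k. c \<alpha> * (\<Prod>i\<in>UNIV. (z $ i) ^ \<alpha> i))"
    using assms unfolding complex_polynomials_def by blast
  have fin: "finite {\<alpha> :: 'n \<Rightarrow> nat. (\<Sum>i\<in>UNIV. \<alpha> i) \<le> l}"
  proof (rule finite_subset)
    show "{\<alpha> :: 'n \<Rightarrow> nat. (\<Sum>i\<in>UNIV. \<alpha> i) \<le> l} \<subseteq> (\<Pi>\<^sub>E i\<in>UNIV. {..l})"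
      by (auto simp: PiE_UNIV_domain) (meson UNIV_I dual_order.trans finite member_le_sum zero_le)
  qed (auto intro: finite_PiE)
  define c' where "c' \<alpha> = (if (\<Sum>i\<in>UNIV. \<alpha> i) \<le> k then c \<alpha> else 0)" for \<alpha>
  have "s = (\<lambda>z. \<Sum>\<alpha> | (\<Sum>i\<in>UNIV. \<alpha> i) \<le> l. c' \<alpha> * (\<Prod>i\<in>UNIV. (z $ i) ^ \<alpha> i))"
    unfolding s c'_def
    by (intro ext sum.mono_neutral_cong_left fin) (use assms(2) in auto)
  then show ?thesis unfolding complex_polynomials_def by blast
qed

lemma norm_vector_scalar_mult:
  fixes v :: "complex ^ 'n"
  shows "norm (c *s v) = cmod c * norm v"
  by (simp add: norm_vec_def L2_set_def norm_mult power_mult_distrib sum_distrib_left[symmetric]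
      real_sqrt_mult)

lemma complex_polynomial_Schwarz:
  fixes s :: "complex ^ 'n \<Rightarrow> complex"
  assumes s: "s \<in> complex_polynomials k" and \<tau>: "\<tau> > 0" and v: "norm v < \<tau>"
    and B: "\<And>z. z \<in> ball q \<tau> \<Longrightarrow> cmod (s z) \<le> B"
  shows "cmod (s (q + v) - s q) \<le> 2 * B * norm v / \<tau>"
proof (cases "v = 0")
  case False
  define v' where "v' = complex_of_real (\<tau> / norm v) *s v"
  have nv': "norm v' = \<tau>" using False \<tau> by (simp add: v'_def norm_vector_scalar_mult norm_divide)
  obtain p where p: "\<And>\<zeta>. poly p \<zeta> = s (q + \<zeta> *s v')"
    using complex_polynomial_on_line[OF s] by metis
  have B0: "0 \<le> B" using B[of q] \<tau> by (smt (verit) norm_ge_zero centre_in_ball)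
  have le: "cmod (s (q + v) - s q) \<le> B' * norm v / \<tau>" if B': "B' > 2 * B" for B'
  proof -
    define f where "f \<zeta> = (poly p \<zeta> - poly p 0) / of_real B'" for \<zeta>
    have "cmod (f \<zeta>) < 1" if "cmod \<zeta> < 1" for \<zeta>
    proof -
      have "q + \<zeta> *s v' \<in> ball q \<tau>"
        using that \<tau> by (simp add: dist_norm norm_vector_scalar_mult nv')
      then have "cmod (poly p \<zeta>) \<le> B" "cmod (poly p 0) \<le> B"
        using B[of q] \<tau> by (auto simp: p intro: B)
      then have "cmod (poly p \<zeta> - poly p 0) < B'"
        using norm_triangle_ineq4[of "poly p \<zeta>" "poly p 0"] B' by linarith
      then show ?thesis using B' B0 by (simp add: f_def norm_divide)
    qed
    moreover have "f holomorphic_on ball 0 1"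
      unfolding f_def by (intro holomorphic_intros) (use B' B0 in auto)
    moreover have "f 0 = 0" by (simp add: f_def)
    moreover have "cmod (of_real (norm v / \<tau>)) < 1" using v \<tau> by (simp add: norm_divide)
    ultimately have "cmod (f (of_real (norm v / \<tau>))) \<le> cmod (of_real (norm v / \<tau>))"
      by (intro Schwarz_Lemma(1))
    also have "\<dots> = norm v / \<tau>" using \<tau> by (simp add: norm_divide)
    finally have "cmod (f (of_real (norm v / \<tau>))) \<le> norm v / \<tau>" .
    moreover have "of_real (norm v / \<tau>) *s v' = v"
      using False \<tau> by (simp add: v'_def vector_smult_assoc)
    then have "f (of_real (norm v / \<tau>)) = (s (q + v) - s q) / of_real B'"
      by (simp only: f_def p) simp
    ultimately have "cmod (s (q + v) - s q) / B' \<le> norm v / \<tau>"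
      using B' B0 by (simp only: norm_divide norm_of_real)
    then show ?thesis
      using B' B0 \<tau> by (simp add: field_simps)
  qed
  show ?thesis
  proof (rule ccontr)
    assume "\<not> ?thesis"
    then have "2 * B < cmod (s (q + v) - s q) * \<tau> / norm v"
      using False \<tau> by (simp add: field_simps)
    then obtain B' where "2 * B < B'" "B' < cmod (s (q + v) - s q) * \<tau> / norm v"
      using dense by blast
    with le[of B'] show False using False \<tau> by (simp add: field_simps)
  qed
qed auto

text \<open>
  One coordinate at a time: after the coordinates in \<open>S\<close> have been made complex, the polynomial in
  the next coordinate is still controlled on a segment.
\<close>

lemma complex_polynomial_growth_near_corner:
  fixes s :: "complex ^ 'n \<Rightarrow> complex" and d :: "'n \<Rightarrow> complex ^ 'n"
  assumes s: "s \<in> complex_polynomials k" and \<rho>: "\<rho> > 0" and \<theta>: "0 \<le> \<theta>" "\<theta> < 1"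
    and M: "\<And>x. (\<And>i. 0 \<le> x i \<and> x i \<le> \<rho>) \<Longrightarrow> cmod (s (q + (\<Sum>i\<in>UNIV. of_real (x i) *s d i))) \<le> M"
    and w: "\<And>i. cmod (w i) \<le> \<rho> * \<theta>\<^sup>2 / 4"
  shows "cmod (s (q + (\<Sum>i\<in>UNIV. w i *s d i))) * (1 - \<theta>) ^ (k * CARD('n)) \<le> M"
proof -
  have "\<forall>w. (\<forall>i\<in>S. cmod (w i) \<le> \<rho> * \<theta>\<^sup>2 / 4) \<and> (\<forall>i\<in>-S. w i \<in> of_real ` {0..\<rho>}) \<longrightarrow>
      cmod (s (q + (\<Sum>i\<in>UNIV. w i *s d i))) * (1 - \<theta>) ^ (k * card S) \<le> M" for S :: "'n set"
  proof (induction S rule: finite_induct[OF finite])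
    case 1
    show ?case
    proof (intro allI impI, elim conjE)
      fix w :: "'n \<Rightarrow> complex" assume wr: "\<forall>i\<in>- {}. w i \<in> of_real ` {0..\<rho>}"
      have w: "w i = of_real (Re (w i)) \<and> 0 \<le> Re (w i) \<and> Re (w i) \<le> \<rho>" for i
      proof -
        have "w i \<in> of_real ` {0..\<rho>}" using wr by simp
        then show ?thesis by auto
      qed
      then have eq: "(\<Sum>i\<in>UNIV. w i *s d i) = (\<Sum>i\<in>UNIV. of_real (Re (w i)) *s d i)"
        using w by (intro sum.cong refl arg_cong2[where f="(*s)"]) blast+
      have "cmod (s (q + (\<Sum>i\<in>UNIV. of_real (Re (w i)) *s d i))) \<le> M"
        by (rule M) (use w in blast)
      then show "cmod (s (q + (\<Sum>i\<in>UNIV. w i *s d i))) * (1 - \<theta>) ^ (k * card {}) \<le> M"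
        unfolding eq by simp
    qed
  next
    case (2 j S)
    show ?case
    proof (intro allI impI, elim conjE)
      fix w :: "'n \<Rightarrow> complex"
      assume wS: "\<forall>i\<in>insert j S. cmod (w i) \<le> \<rho> * \<theta>\<^sup>2 / 4"
        and wC: "\<forall>i\<in>- insert j S. w i \<in> of_real ` {0..\<rho>}"
      define u where "u = q + (\<Sum>i\<in>UNIV-{j}. w i *s d i)"
      have split: "q + (\<Sum>i\<in>UNIV. (w(j := \<zeta>)) i *s d i) = u + \<zeta> *s d j" for \<zeta>
        unfolding u_def by (subst sum.remove[of UNIV j]) (auto simp: algebra_simps)
      obtain p where p: "degree p \<le> k" "\<And>\<zeta>. poly p \<zeta> = s (u + \<zeta> *s d j)"
        using complex_polynomial_on_line[OF s] by metis
      have pos: "0 < (1 - \<theta>) ^ (k * card S)" using \<theta> by simp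
      have "cmod (poly p (w j)) * (1 - \<theta>) ^ k \<le> M / (1 - \<theta>) ^ (k * card S)"
      proof (rule polynomial_growth_near_endpoint[OF p(1) \<rho> _ \<theta>])
        fix x :: real assume x: "0 \<le> x" "x \<le> \<rho>"
        have "cmod (s (q + (\<Sum>i\<in>UNIV. (w(j := of_real x)) i *s d i))) * (1 - \<theta>) ^ (k * card S) \<le> M"
          using 2 wS wC x by (intro "2.IH"[rule_format]) auto
        then show "cmod (poly p (of_real x)) \<le> M / (1 - \<theta>) ^ (k * card S)"
          unfolding split p(2) using pos by (simp add: field_simps)
      next
        show "cmod (w j) \<le> \<rho> * \<theta>\<^sup>2 / 4" using wS by auto
      qed
      then have "cmod (poly p (w j)) * (1 - \<theta>) ^ (k + k * card S) \<le> M"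
        using pos by (simp add: field_simps power_add)
      moreover have "poly p (w j) = s (q + (\<Sum>i\<in>UNIV. w i *s d i))"
        using split[of "w j"] by (simp add: p(2))
      ultimately show "cmod (s (q + (\<Sum>i\<in>UNIV. w i *s d i))) * (1 - \<theta>) ^ (k * card (insert j S)) \<le> M"
        using 2 by simp
    qed
  qed
  from this[of UNIV, rule_format, of w] w show ?thesis by auto
qed

section \<open>Polynomials near a totally real corner\<close>

definition parameter_cube :: "real \<Rightarrow> ('n \<Rightarrow> real) set" where
  "parameter_cube a = {t. \<forall>i. 0 \<le> t i \<and> t i \<le> a}"

lemma parameter_cube_mono: "t \<in> parameter_cube b \<Longrightarrow> b \<le> a \<Longrightarrow> t \<in> parameter_cube a"
  unfolding parameter_cube_def by (auto intro: order_trans)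

text \<open>
  The quantitative form in which genericity and smoothness are used: \<open>h\<close> parametrises a piece of \<open>K\<close>
  with corner \<open>h 0\<close>, it differs from its linearisation by a quadratic error, and its partial
  derivatives \<open>d t i\<close> form a basis of \<open>\<complex>\<^sup>n\<close> over \<open>\<complex>\<close>, with coordinate functions bounded by \<open>B\<close>.
\<close>

definition totally_real_corner ::
    "real \<Rightarrow> real \<Rightarrow> real \<Rightarrow> (('n \<Rightarrow> real) \<Rightarrow> complex ^ 'n) \<Rightarrow>
     (('n \<Rightarrow> real) \<Rightarrow> 'n \<Rightarrow> complex ^ 'n) \<Rightarrow> bool" where
  "totally_real_corner a L B h d \<longleftrightarrow>
     (\<forall>t\<in>parameter_cube a. \<forall>u \<rho>. (\<lambda>i. t i + u i) \<in> parameter_cube a \<and> u \<in> parameter_cube \<rho> \<longrightarrow>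
        norm (h (\<lambda>i. t i + u i) - (h t + (\<Sum>i\<in>UNIV. of_real (u i) *s d t i))) \<le> L * \<rho>\<^sup>2) \<and>
     (\<forall>t\<in>parameter_cube a. \<forall>v. \<exists>w.
        v = (\<Sum>i\<in>UNIV. w i *s d t i) \<and> (\<forall>i. cmod (w i) \<le> B * norm v))"

text \<open>
  If the polynomial is under control in a tube of radius \<open>8 L \<rho>\<^sup>2\<close>, the affine cube of side \<open>\<rho>\<close>
  tangent to the corner stays so close to the corner that the Schwarz lemma bounds the polynomial by
  \<open>2 M\<close> on that cube. The growth estimate near a corner then gives control on a ball of radius
  comparable with \<open>\<rho> / k\<^sup>2\<close>, which for small \<open>\<rho>\<close> is larger than the radius of the original tube.
\<close>

lemma tube_enlargement:
  fixes s :: "complex ^ 'n \<Rightarrow> complex" and a L B b M \<rho> :: real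
  assumes corner: "totally_real_corner a L B h d" and L: "L > 0" and B: "B > 0"
    and s: "s \<in> complex_polynomials k" and k: "k \<ge> 1" and \<rho>: "\<rho> > 0" and ba: "b \<le> a"
    and M: "\<And>t. t \<in> parameter_cube a \<Longrightarrow> cmod (s (h t)) \<le> M"
    and tube: "\<And>t z. t \<in> parameter_cube b \<Longrightarrow> z \<in> ball (h t) (8 * L * \<rho>\<^sup>2) \<Longrightarrow> cmod (s z) \<le> 4 * M"
    and t: "t \<in> parameter_cube (b - \<rho>)"
    and z: "z \<in> ball (h t) (\<rho> / (16 * B * (real k)\<^sup>2 * (real CARD('n))\<^sup>2))"
  shows "cmod (s z) \<le> 4 * M"
proof -
  define N where "N = real k * real CARD('n)"
  have N: "N \<ge> 1" unfolding N_def using k by (simp add: Suc_le_eq flip: of_nat_mult)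
  \<comment> \<open>By Bernoulli's inequality, this \<open>\<theta>\<close> keeps the factor in the growth estimate at least \<open>1 / 2\<close>.\<close>
  define \<theta> where "\<theta> = 1 / (2 * N)"
  have \<theta>: "0 \<le> \<theta>" "\<theta> < 1" using N by (auto simp: \<theta>_def field_simps)
  have ta: "t \<in> parameter_cube a"
    using t by (rule parameter_cube_mono) (use ba \<rho> in linarith)
  obtain w where w: "z - h t = (\<Sum>i\<in>UNIV. w i *s d t i)" "\<And>i. cmod (w i) \<le> B * norm (z - h t)"
    using corner ta unfolding totally_real_corner_def by metis
  have "cmod (s (h t + (\<Sum>i\<in>UNIV. w i *s d t i))) * (1 - \<theta>) ^ (k * CARD('n)) \<le> 2 * M"
  proof (rule complex_polynomial_growth_near_corner[OF s \<rho> \<theta>])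
    fix x :: "'n \<Rightarrow> real" assume x: "\<And>i. 0 \<le> x i \<and> x i \<le> \<rho>"
    let ?t = "\<lambda>i. t i + x i"
    have tb: "?t \<in> parameter_cube b"
      using t x unfolding parameter_cube_def by (smt (verit) mem_Collect_eq)
    then have ta': "?t \<in> parameter_cube a" using ba by (rule parameter_cube_mono)
    have x': "x \<in> parameter_cube \<rho>" using x by (simp add: parameter_cube_def)
    define v where "v = h t + (\<Sum>i\<in>UNIV. of_real (x i) *s d t i) - h ?t"
    have "norm (h ?t - (h t + (\<Sum>i\<in>UNIV. of_real (x i) *s d t i))) \<le> L * \<rho>\<^sup>2"
      using corner ta ta' x' unfolding totally_real_corner_def by blast
    then have nv: "norm v \<le> L * \<rho>\<^sup>2" by (simp add: v_def norm_minus_commute)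
    have M0: "0 \<le> M" using M[OF ta] by (meson norm_ge_zero order_trans)
    have pos: "0 < L * \<rho>\<^sup>2" using L \<rho> by simp
    have "cmod (s (h ?t + v) - s (h ?t)) \<le> 2 * (4 * M) * norm v / (8 * L * \<rho>\<^sup>2)"
      by (rule complex_polynomial_Schwarz[OF s]) (use tube[OF tb] nv pos in auto)
    also have "\<dots> \<le> 2 * (4 * M) * (L * \<rho>\<^sup>2) / (8 * L * \<rho>\<^sup>2)"
      using nv M0 pos by (intro divide_right_mono mult_left_mono) auto
    also have "\<dots> = M" using L \<rho> by simp
    finally have "cmod (s (h ?t + v) - s (h ?t)) \<le> M" .
    moreover have "cmod (s (h ?t)) \<le> M" by (rule M[OF ta'])
    ultimately have "cmod (s (h ?t + v)) \<le> 2 * M"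
      using norm_triangle_sub[of "s (h ?t + v)" "s (h ?t)"] by linarith
    then show "cmod (s (h t + (\<Sum>i\<in>UNIV. of_real (x i) *s d t i))) \<le> 2 * M"
      by (simp add: v_def)
  next
    fix i
    have "cmod (w i) \<le> B * norm (z - h t)" by (rule w(2))
    also have "\<dots> \<le> B * (\<rho> / (16 * B * (real k)\<^sup>2 * (real CARD('n))\<^sup>2))"
      using z B by (intro mult_left_mono) (auto simp: dist_norm norm_minus_commute)
    also have "\<dots> = \<rho> * \<theta>\<^sup>2 / 4"
      using B by (simp add: \<theta>_def N_def power_divide power_mult_distrib)
    finally show "cmod (w i) \<le> \<rho> * \<theta>\<^sup>2 / 4" .
  qed
  then have le: "cmod (s z) * (1 - \<theta>) ^ (k * CARD('n)) \<le> 2 * M"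
    by (simp flip: w(1))
  have "1 / 2 = 1 + real (k * CARD('n)) * (- \<theta>)"
    using k by (simp add: \<theta>_def N_def)
  also have "\<dots> \<le> (1 + (- \<theta>)) ^ (k * CARD('n))"
    by (rule Bernoulli_inequality) (use \<theta> in auto)
  finally have "1 / 2 \<le> (1 - \<theta>) ^ (k * CARD('n))" by simp
  then have "cmod (s z) * (1 / 2) \<le> cmod (s z) * (1 - \<theta>) ^ (k * CARD('n))"
    by (rule mult_left_mono) simp
  with le show ?thesis by linarith
qed

text \<open>
  By continuity every polynomial is bounded by \<open>4 M\<close> on some tube, however thin. Enlarging the tube
  by the factor \<open>4\<close>, again and again, leads to a radius of order \<open>1 / k\<^sup>4\<close> that depends on the
  geometry only. Each enlargement costs a little of the parameter cube; the losses form a geometric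
  series, and the corner itself survives.
\<close>

lemma polynomial_bound_near_corner:
  fixes s :: "complex ^ 'n \<Rightarrow> complex" and a L B M :: real
  assumes corner: "totally_real_corner a L B h d" and a: "a > 0" and L: "L > 0" and B: "B > 0"
    and bdd: "bounded (h ` parameter_cube a)"
    and s: "s \<in> complex_polynomials k" and k: "k \<ge> 1" and M0: "M > 0"
    and M: "\<And>t. t \<in> parameter_cube a \<Longrightarrow> cmod (s (h t)) \<le> M"
    and z: "z \<in> ball (h (\<lambda>_. 0)) (8 * L * (min a (1 / (512 * L * B * (real CARD('n))\<^sup>2)))\<^sup>2 / real k ^ 4)"
  shows "cmod (s z) \<le> 4 * M"
proof -
  \<comment> \<open>Up to this side, the tube of radius \<open>8 L \<rho>\<^sup>2\<close> grows at least by the factor \<open>4\<close>, which doubles the side.\<close>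
  define \<rho> where "\<rho> = min a (1 / (512 * L * B * (real CARD('n))\<^sup>2)) / (real k)\<^sup>2"
  have k2: "(real k)\<^sup>2 \<ge> 1" using k by simp
  have \<rho>: "\<rho> > 0" using a L B k unfolding \<rho>_def by simp
  have "\<rho> \<le> min a (1 / (512 * L * B * (real CARD('n))\<^sup>2)) / 1"
    unfolding \<rho>_def using k2 k a L B by (intro divide_left_mono) auto
  then have \<rho>a: "\<rho> \<le> a" by simp
  have "\<rho> \<le> 1 / (512 * L * B * (real CARD('n))\<^sup>2) / (real k)\<^sup>2"
    unfolding \<rho>_def by (intro divide_right_mono) auto
  then have \<rho>k: "\<rho> * (512 * L * B * (real CARD('n))\<^sup>2 * (real k)\<^sup>2) \<le> 1"
    using L B k by (simp add: field_simps)
  define Q where "Q j \<longleftrightarrow> (\<forall>t\<in>parameter_cube (a * (1 - 1 / 2 ^ j)).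
      \<forall>z\<in>ball (h t) (8 * L * (\<rho> / 2 ^ j)\<^sup>2). cmod (s z) \<le> 4 * M)" for j :: nat
  have step: "Q j" if "Q (Suc j)" for j
    unfolding Q_def
  proof (intro ballI)
    fix t z
    assume t: "t \<in> parameter_cube (a * (1 - 1 / 2 ^ j))" and z: "z \<in> ball (h t) (8 * L * (\<rho> / 2 ^ j)\<^sup>2)"
    define \<sigma> where "\<sigma> = \<rho> / 2 ^ Suc j"
    have \<sigma>: "\<sigma> > 0" using \<rho> by (simp add: \<sigma>_def)
    have \<sigma>\<rho>: "\<sigma> \<le> \<rho>"
      unfolding \<sigma>_def using \<rho> self_le_power[of 2 "Suc j"] one_le_power[of "2::real" "Suc j"]
      by (simp add: divide_le_eq_1 field_simps)
    show "cmod (s z) \<le> 4 * M"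
    proof (rule tube_enlargement[OF corner L B s k \<sigma> _ M])
      show "a * (1 - 1 / 2 ^ Suc j) \<le> a" using a by (simp add: field_simps)
      show "cmod (s z) \<le> 4 * M"
        if "t \<in> parameter_cube (a * (1 - 1 / 2 ^ Suc j))" "z \<in> ball (h t) (8 * L * \<sigma>\<^sup>2)" for t z
        using \<open>Q (Suc j)\<close> that unfolding Q_def \<sigma>_def by blast
      have "\<sigma> \<le> a / 2 ^ Suc j" unfolding \<sigma>_def using \<rho>a by (intro divide_right_mono) auto
      then have "a * (1 - 1 / 2 ^ j) \<le> a * (1 - 1 / 2 ^ Suc j) - \<sigma>" by (simp add: field_simps)
      then show "t \<in> parameter_cube (a * (1 - 1 / 2 ^ Suc j) - \<sigma>)"
        by (rule parameter_cube_mono[OF t])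
      have "\<sigma> * (512 * L * B * (real CARD('n))\<^sup>2 * (real k)\<^sup>2) \<le> \<rho> * (512 * L * B * (real CARD('n))\<^sup>2 * (real k)\<^sup>2)"
        using \<sigma>\<rho> L B by (intro mult_right_mono) auto
      then have "\<sigma> * (512 * L * B * (real CARD('n))\<^sup>2 * (real k)\<^sup>2) \<le> 1" using \<rho>k by linarith
      then have "\<sigma> * (\<sigma> * (512 * L * B * (real CARD('n))\<^sup>2 * (real k)\<^sup>2)) \<le> \<sigma> * 1"
        using \<sigma> by (intro mult_left_mono) auto
      then have "32 * L * \<sigma>\<^sup>2 \<le> \<sigma> / (16 * B * (real k)\<^sup>2 * (real CARD('n))\<^sup>2)"
        using B k by (simp add: field_simps power2_eq_square)
      moreover have "8 * L * (\<rho> / 2 ^ j)\<^sup>2 = 32 * L * \<sigma>\<^sup>2"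
        by (simp add: \<sigma>_def power_divide)
      ultimately have "8 * L * (\<rho> / 2 ^ j)\<^sup>2 \<le> \<sigma> / (16 * B * (real k)\<^sup>2 * (real CARD('n))\<^sup>2)"
        by linarith
      then show "z \<in> ball (h t) (\<sigma> / (16 * B * (real k)\<^sup>2 * (real CARD('n))\<^sup>2))"
        by (rule subset_ball[THEN subsetD, OF _ z])
    qed
  qed
  obtain p R where R: "h ` parameter_cube a \<subseteq> cball p R"
    using bdd unfolding bounded_subset_cball by blast
  have "uniformly_continuous_on (cball p (R + 1)) s"
    by (intro compact_uniformly_continuous continuous_on_complex_polynomial[OF s] compact_cball)
  then obtain \<delta> where \<delta>: "\<delta> > 0"
    "\<And>z z'. z \<in> cball p (R + 1) \<Longrightarrow> z' \<in> cball p (R + 1) \<Longrightarrow> dist z' z < \<delta> \<Longrightarrow> dist (s z') (s z) < M"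
    unfolding uniformly_continuous_on_def using M0 by metis
  have "(\<lambda>j. 8 * L * (\<rho> * (1 / 2) ^ j)\<^sup>2) \<longlonglongrightarrow> 8 * L * (\<rho> * 0)\<^sup>2"
    by (intro tendsto_intros LIMSEQ_power_zero) auto
  then have "eventually (\<lambda>j. 8 * L * (\<rho> * (1 / 2) ^ j)\<^sup>2 < min \<delta> 1) sequentially"
    by (rule order_tendstoD) (use \<delta> in auto)
  then obtain J where "8 * L * (\<rho> * (1 / 2) ^ J)\<^sup>2 < min \<delta> 1"
    using eventually_happens'[OF sequentially_bot] by blast
  then have J: "8 * L * (\<rho> / 2 ^ J)\<^sup>2 < min \<delta> 1" by (simp add: power_divide)
  have "Q J"
    unfolding Q_def
  proof (intro ballI)
    fix t z
    assume t: "t \<in> parameter_cube (a * (1 - 1 / 2 ^ J))" and z: "z \<in> ball (h t) (8 * L * (\<rho> / 2 ^ J)\<^sup>2)"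
    have "a * (1 - 1 / 2 ^ J) \<le> a" using a by (simp add: field_simps)
    with t have ta: "t \<in> parameter_cube a" by (rule parameter_cube_mono)
    then have hp: "dist p (h t) \<le> R" using R by auto
    moreover have d: "dist (h t) z < min \<delta> 1" using z J by simp
    ultimately have "dist p z \<le> R + 1" using dist_triangle[of p z "h t"] by simp
    then have "dist (s z) (s (h t)) < M"
      using \<delta>(2)[of "h t" z] hp d by (simp add: dist_commute)
    then show "cmod (s z) \<le> 4 * M"
      using M[OF ta] M0 norm_triangle_sub[of "s z" "s (h t)"] by (simp add: dist_norm)
  qed
  then have "Q 0"
  proof (induction J)
    case (Suc J)
    then show ?case using step by blast
  qed
  moreover have "(\<lambda>_. 0) \<in> parameter_cube (a * (1 - 1 / 2 ^ 0))"
    by (simp add: parameter_cube_def)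
  moreover have "8 * L * (\<rho> / 2 ^ 0)\<^sup>2
      = 8 * L * (min a (1 / (512 * L * B * (real CARD('n))\<^sup>2)))\<^sup>2 / real k ^ 4"
    by (simp add: \<rho>_def power_divide flip: power_mult)
  ultimately show ?thesis using z unfolding Q_def by metis
qed

text \<open>
  The values near \<open>z\<^sub>0\<close> on \<open>K\<close> control the values on a neighbourhood in \<open>\<complex>\<^sup>n\<close> that shrinks only
  polynomially in the degree. The factor \<open>4\<close> is the bound that tube enlargement reproduces.
\<close>

definition tube_bounded :: "(complex ^ 'n) set \<Rightarrow> real \<Rightarrow> real \<Rightarrow> complex ^ 'n \<Rightarrow> bool" where
  "tube_bounded K r c z\<^sub>0 \<longleftrightarrow> (\<forall>k\<ge>1. \<forall>s\<in>complex_polynomials k. \<forall>M>0.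
     (\<forall>z\<in>K \<inter> ball z\<^sub>0 r. cmod (s z) \<le> M) \<longrightarrow> (\<forall>z\<in>ball z\<^sub>0 (c / real k ^ 4). cmod (s z) \<le> 4 * M))"

lemma tube_bounded_mono:
  assumes "tube_bounded K r c z\<^sub>0" "c' \<le> c"
  shows "tube_bounded K r c' z\<^sub>0"
proof -
  have "ball z\<^sub>0 (c' / real k ^ 4) \<subseteq> ball z\<^sub>0 (c / real k ^ 4)" for k
    using assms(2) by (intro subset_ball divide_right_mono) auto
  then show ?thesis using assms(1) unfolding tube_bounded_def by blast
qed

lemma tube_bounded_of_totally_real_corner:
  fixes h :: "('n \<Rightarrow> real) \<Rightarrow> complex ^ 'n"
  assumes "totally_real_corner a L B h d" "a > 0" "L > 0" "B > 0"
    and sub: "h ` parameter_cube a \<subseteq> K \<inter> ball (h (\<lambda>_. 0)) r"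
  shows "tube_bounded K r (8 * L * (min a (1 / (512 * L * B * (real CARD('n))\<^sup>2)))\<^sup>2) (h (\<lambda>_. 0))"
  unfolding tube_bounded_def
proof (intro allI impI ballI)
  fix k s M z
  assume k: "1 \<le> k" and s: "s \<in> complex_polynomials k" and M: "0 < M"
    and le: "\<forall>z\<in>K \<inter> ball (h (\<lambda>_. 0)) r. cmod (s z) \<le> M"
    and z: "z \<in> ball (h (\<lambda>_. 0)) (8 * L * (min a (1 / (512 * L * B * (real CARD('n))\<^sup>2)))\<^sup>2 / real k ^ 4)"
  show "cmod (s z) \<le> 4 * M"
  proof (rule polynomial_bound_near_corner[OF assms(1-4) _ s k M _ z])
    show "bounded (h ` parameter_cube a)"
      using sub by (meson bounded_ball bounded_subset le_inf_iff)
    show "cmod (s (h t)) \<le> M" if "t \<in> parameter_cube a" for t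
      using le sub that by blast
  qed
qed

section \<open>From the local estimate to the Bernstein-Markov property\<close>

text \<open>
  Let \<open>A\<close> be the value of the weighted polynomial at a maximum point \<open>z\<^sub>0\<close>. On a fixed small ball the
  weight oscillates by at most \<open>exp (k \<delta>)\<close>, so the hypothesis bounds the polynomial by
  \<open>4 A exp (k \<delta>)\<close>, up to the weight at \<open>z\<^sub>0\<close>, on a ball of polynomially small radius. By the Schwarz
  lemma it is still at least half as large as at \<open>z\<^sub>0\<close> on a ball of radius \<open>exp (- k \<delta>)\<close> times a power
  of \<open>k\<close>, and the measure of that ball decays at most like \<open>exp (- k \<delta> \<tau>)\<close> times a power of \<open>k\<close>.
\<close>

lemma bernstein_markov_of_uniform_tube_bound:
  fixes K :: "(complex ^ 'n) set" and \<mu> :: "(complex ^ 'n) measure" and Q :: "complex ^ 'n \<Rightarrow> real"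
  assumes K: "compact K" and sets: "sets \<mu> = sets borel" and fin: "finite_measure \<mu>"
    and \<tau>: "\<tau> > 0" and r0: "r\<^sub>0 > 0"
    and mass: "\<And>z r. z \<in> K \<Longrightarrow> 0 < r \<Longrightarrow> r \<le> r\<^sub>0 \<Longrightarrow> measure \<mu> (ball z r \<inter> K) \<ge> r powr \<tau>"
    and tube: "\<And>r. r > 0 \<Longrightarrow> \<exists>c>0. \<forall>z\<in>K. tube_bounded K r c z"
    and Q: "continuous_on K Q"
  shows "bernstein_markov \<mu> K Q"
  unfolding bernstein_markov_def
proof (intro allI impI)
  fix \<epsilon> :: real assume \<epsilon>: "\<epsilon> > 0"
  define \<delta> where "\<delta> = \<epsilon> / (2 * (2 + \<tau>))"
  have \<delta>: "\<delta> > 0" and \<delta>\<epsilon>: "\<delta> * (2 + \<tau>) = \<epsilon> / 2" using \<epsilon> \<tau> by (auto simp: \<delta>_def field_simps)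
  have "uniformly_continuous_on K Q" using K Q by (intro compact_uniformly_continuous)
  then obtain r where r: "r > 0"
    "\<And>z z'. z \<in> K \<Longrightarrow> z' \<in> K \<Longrightarrow> dist z' z < r \<Longrightarrow> dist (Q z') (Q z) < \<delta>"
    unfolding uniformly_continuous_on_def using \<delta> by metis
  obtain c where c: "c > 0"
    "\<And>z\<^sub>0 k s M z. z\<^sub>0 \<in> K \<Longrightarrow> k \<ge> 1 \<Longrightarrow> s \<in> complex_polynomials k \<Longrightarrow> M > 0 \<Longrightarrow>
        (\<And>z. z \<in> K \<inter> ball z\<^sub>0 r \<Longrightarrow> cmod (s z) \<le> M) \<Longrightarrow> z \<in> ball z\<^sub>0 (c / real k ^ 4) \<Longrightarrow> cmod (s z) \<le> 4 * M"
    using tube[OF r(1)] unfolding tube_bounded_def by metis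
  define b where "b = min c (min r r\<^sub>0) / 16"
  have b: "b > 0" "16 * b \<le> c" "b \<le> r" "b \<le> r\<^sub>0"
    using c(1) r(1) r0 by (auto simp: b_def min_def)
  \<comment> \<open>With this \<open>\<eta>\<close>, the inequality \<open>x \<le> exp x\<close> at \<open>x = \<eta> (k + 1)\<close> absorbs the power \<open>(k + 1) powr (4 \<tau>)\<close>
    in \<open>exp (\<epsilon> k / 2)\<close>; the other half of \<open>\<epsilon>\<close> pays for the oscillation of the weight.\<close>
  define \<eta> where "\<eta> = \<epsilon> / (8 * \<tau>)"
  have \<eta>: "\<eta> > 0" using \<epsilon> \<tau> by (simp add: \<eta>_def)
  define C where "C = 4 / (b powr \<tau> * \<eta> powr (4 * \<tau>) * exp (- \<epsilon> / 2))"
  have C: "C > 0" using b \<eta> by (simp add: C_def)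
  \<comment> \<open>The degree is counted as \<open>k + 1\<close>, because the local estimate is about positive degrees.\<close>
  define R where "R k = b / real (k + 1) ^ 4 * exp (- real k * \<delta>)" for k :: nat
  have R: "R k > 0" "R k \<le> b" for k
  proof -
    show "R k > 0" using b by (simp add: R_def)
    have "b / real (k + 1) ^ 4 \<le> b / 1"
      using b(1) one_le_power[of "real (k + 1)" 4] by (intro divide_left_mono) auto
    moreover have "exp (- real k * \<delta>) \<le> 1" using \<delta> by simp
    ultimately have "b / real (k + 1) ^ 4 * exp (- real k * \<delta>) \<le> b / 1 * 1"
      using b(1) by (intro mult_mono) auto
    then show "R k \<le> b" by (simp add: R_def)
  qed
  have mass_lower: "4 * exp (2 * real k * \<delta>) \<le> C * exp (\<epsilon> * real k) * R k powr \<tau>" for k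
  proof -
    have "\<eta> * real (k + 1) \<le> exp (\<eta> * real (k + 1))"
      using exp_ge_add_one_self[of "\<eta> * real (k + 1)"] by linarith
    then have "(\<eta> * real (k + 1)) powr (4 * \<tau>) \<le> exp (\<eta> * real (k + 1)) powr (4 * \<tau>)"
      using \<eta> \<tau> by (intro powr_mono2) auto
    also have "\<dots> = exp (\<epsilon> / 2 * real (k + 1))"
      using \<tau> by (simp add: powr_def \<eta>_def)
    finally have 1: "\<eta> powr (4 * \<tau>) * real (k + 1) powr (4 * \<tau>) \<le> exp (\<epsilon> / 2 * real (k + 1))"
      using \<eta> by (simp add: powr_mult)
    have "R k powr \<tau> = b powr \<tau> / real (k + 1) powr (4 * \<tau>) * exp (- real k * \<delta> * \<tau>)"
    proof -
      have "(real (k + 1) ^ 4) powr \<tau> = real (k + 1) powr (4 * \<tau>)"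
      proof -
        have "real (k + 1) ^ 4 = real (k + 1) powr 4" by (simp add: powr_numeral)
        then show ?thesis by (simp only: powr_powr)
      qed
      moreover have "exp (- real k * \<delta>) powr \<tau> = exp (- real k * \<delta> * \<tau>)"
        by (simp add: powr_def)
      moreover have "R k powr \<tau> = b powr \<tau> / (real (k + 1) ^ 4) powr \<tau> * exp (- real k * \<delta>) powr \<tau>"
        unfolding R_def using b(1) by (subst powr_mult) (simp_all add: powr_divide)
      ultimately show ?thesis by simp
    qed
    moreover have "exp (\<epsilon> / 2 + \<epsilon> * real k - real k * \<delta> * \<tau>)
        = exp (\<epsilon> * real k) * exp (- real k * \<delta> * \<tau>) / exp (- \<epsilon> / 2)"
      by (simp flip: exp_add exp_diff)
    ultimately have "C * exp (\<epsilon> * real k) * R k powr \<tau>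
        = 4 * exp (\<epsilon> / 2 + \<epsilon> * real k - real k * \<delta> * \<tau>) / (\<eta> powr (4 * \<tau>) * real (k + 1) powr (4 * \<tau>))"
      using b by (simp add: C_def)
    also have "\<dots> \<ge> 4 * exp (\<epsilon> / 2 + \<epsilon> * real k - real k * \<delta> * \<tau>) / exp (\<epsilon> / 2 * real (k + 1))"
      using 1 \<eta> by (intro divide_left_mono) auto
    also have "4 * exp (\<epsilon> / 2 + \<epsilon> * real k - real k * \<delta> * \<tau>) / exp (\<epsilon> / 2 * real (k + 1))
        = 4 * exp (\<epsilon> / 2 + \<epsilon> * real k - real k * \<delta> * \<tau> - \<epsilon> / 2 * real (k + 1))"
      by (simp add: exp_diff)
    also have "\<epsilon> / 2 + \<epsilon> * real k - real k * \<delta> * \<tau> - \<epsilon> / 2 * real (k + 1)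
        = real k * (\<epsilon> / 2) - real k * \<delta> * \<tau>"
      by (simp add: field_simps)
    also have "\<dots> = 2 * real k * \<delta>"
      by (simp add: \<delta>\<epsilon>[symmetric] algebra_simps)
    finally show ?thesis .
  qed
  have main: "ennreal ((cmod (s z))\<^sup>2 * exp (- 2 * real k * Q z))
      \<le> ennreal (C * exp (\<epsilon> * real k)) * weighted_L2_norm_sq \<mu> K Q k s"
    if s: "s \<in> polynomials_on k K" and z: "z \<in> K" for k s z
  proof -
    obtain p where p: "p \<in> complex_polynomials k" "s = restrict p K"
      using s unfolding polynomials_on_def by blast
    have sp: "s z = p z" if "z \<in> K" for z using that p by simp
    define W where "W z = cmod (p z) * exp (- real k * Q z)" for z
    have W2: "(cmod (s z))\<^sup>2 * exp (- 2 * real k * Q z) = (W z)\<^sup>2" if "z \<in> K" for z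
      by (simp add: W_def sp[OF that] power_mult_distrib flip: exp_double)
    have "continuous_on K W"
      unfolding W_def by (intro continuous_intros Q continuous_on_complex_polynomial[OF p(1)])
    then obtain z0 where z0: "z0 \<in> K" "\<And>z. z \<in> K \<Longrightarrow> W z \<le> W z0"
      using continuous_attains_sup[OF K] z by blast
    have W0: "0 \<le> W z" for z by (simp add: W_def)
    show ?thesis
    proof (cases "p z0 = 0")
      case True
      then have "W z0 = 0" by (simp add: W_def)
      then have "W z = 0" using z0(2)[OF z] W0[of z] by linarith
      then show ?thesis by (simp only: W2[OF z]) simp
    next
      case False
      then have pz0: "cmod (p z0) > 0" by simp
      have p': "p \<in> complex_polynomials (k + 1)" using p(1) by (rule complex_polynomials_mono) simp
      have Q_osc: "\<bar>Q z - Q z0\<bar> \<le> \<delta>" if "z \<in> K" "dist z z0 < r" for z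
        using r(2)[OF z0(1) that] by (simp add: dist_real_def)
      have p_le: "cmod (p z) \<le> 4 * (cmod (p z0) * exp (real k * \<delta>))"
        if "z \<in> ball z0 (c / real (k + 1) ^ 4)" for z
      proof (rule c(2)[OF z0(1) _ p' _ _ that])
        fix z assume z: "z \<in> K \<inter> ball z0 r"
        have "cmod (p z) = W z * exp (real k * Q z)"
          by (simp add: W_def mult.assoc flip: exp_add)
        also have "\<dots> \<le> W z0 * exp (real k * Q z)"
          using z0(2) z by (intro mult_right_mono) auto
        also have "\<dots> = cmod (p z0) * exp (real k * (Q z - Q z0))"
          by (simp add: W_def mult.assoc algebra_simps flip: exp_add)
        also have "\<dots> \<le> cmod (p z0) * exp (real k * \<delta>)"
          using Q_osc[of z] z by (intro mult_left_mono) (auto simp: dist_commute intro!: mult_left_mono)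
        finally show "cmod (p z) \<le> cmod (p z0) * exp (real k * \<delta>)" .
      qed (use pz0 in auto)
      have near: "(W z0)\<^sup>2 * exp (- 2 * real k * \<delta>) / 4 \<le> (W z)\<^sup>2"
        if z: "z \<in> ball z0 (R k) \<inter> K" for z
      proof -
        define t where "t = c / real (k + 1) ^ 4"
        have t: "t > 0" using c(1) by (simp add: t_def)
        have nz: "norm (z - z0) < R k" using z by (simp add: dist_norm norm_minus_commute)
        have "16 * R k * exp (real k * \<delta>) = 16 * b / real (k + 1) ^ 4"
          by (simp add: R_def exp_minus)
        also have "\<dots> \<le> t" unfolding t_def using b(2) by (intro divide_right_mono) auto
        finally have Rt: "16 * R k * exp (real k * \<delta>) \<le> t" .
        have "1 \<le> exp (real k * \<delta>)" using \<delta> by simp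
        then have "R k * 1 \<le> R k * exp (real k * \<delta>)" using R by (intro mult_left_mono) (auto simp: less_imp_le)
        then have "norm (z - z0) < t" using nz Rt R(1)[of k] by linarith
        then have "cmod (p (z0 + (z - z0)) - p z0) \<le> 2 * (4 * (cmod (p z0) * exp (real k * \<delta>))) * norm (z - z0) / t"
          by (intro complex_polynomial_Schwarz[OF p(1) t]) (use p_le t_def in auto)
        also have "\<dots> \<le> 2 * (4 * (cmod (p z0) * exp (real k * \<delta>))) * R k / t"
          using nz t by (intro divide_right_mono mult_left_mono) auto
        also have "\<dots> = cmod (p z0) / 2 * ((16 * R k * exp (real k * \<delta>)) / t)" by simp
        also have "\<dots> \<le> cmod (p z0) / 2 * 1"
          using Rt t by (intro mult_left_mono) auto
        finally have "cmod (p z - p z0) \<le> cmod (p z0) / 2" by simp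
        then have half: "cmod (p z0) / 2 \<le> cmod (p z)"
          using norm_triangle_ineq2[of "p z0" "p z"] by (simp add: norm_minus_commute)
        have "dist z z0 < r" using nz R(2)[of k] b(3) by (simp add: dist_norm)
        then have "real k * Q z \<le> real k * (Q z0 + \<delta>)"
          using Q_osc[of z] z by (intro mult_left_mono) auto
        then have "exp (- real k * Q z0) * exp (- real k * \<delta>) \<le> exp (- real k * Q z)"
          by (simp add: algebra_simps flip: exp_add)
        then have "cmod (p z0) / 2 * (exp (- real k * Q z0) * exp (- real k * \<delta>)) \<le> W z"
          unfolding W_def using half by (intro mult_mono) auto
        then have "(W z0 * exp (- real k * \<delta>) / 2)\<^sup>2 \<le> (W z)\<^sup>2"
          by (intro power_mono) (auto simp: W_def)
        then show ?thesis by (simp add: power_mult_distrib power_divide mult.assoc flip: exp_double)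
      qed
      define a where "a = (W z0)\<^sup>2 * exp (- 2 * real k * \<delta>) / 4"
      have meas: "ball z0 (R k) \<inter> K \<in> sets \<mu>"
        unfolding sets using K by (intro sets.Int) (auto intro: borel_compact)
      have "ennreal (a * R k powr \<tau>) \<le> ennreal a * ennreal (measure \<mu> (ball z0 (R k) \<inter> K))"
        using mass[OF z0(1) R(1)] R(2)[of k] b(4)
        by (subst ennreal_mult[symmetric]) (auto simp: a_def intro!: ennreal_leI mult_left_mono)
      also have "\<dots> = ennreal a * emeasure \<mu> (ball z0 (R k) \<inter> K)"
        using finite_measure.emeasure_eq_measure[OF fin] by simp
      also have "\<dots> = (\<integral>\<^sup>+z. ennreal a * indicator (ball z0 (R k) \<inter> K) z \<partial>\<mu>)"
        using meas by (simp add: nn_integral_cmult_indicator)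
      also have "\<dots> \<le> weighted_L2_norm_sq \<mu> K Q k s"
        unfolding weighted_L2_norm_sq_def
      proof (rule nn_integral_mono)
        fix z
        show "ennreal a * indicator (ball z0 (R k) \<inter> K) z
            \<le> ennreal ((cmod (s z))\<^sup>2 * exp (- 2 * real k * Q z)) * indicator K z"
          using near[of z] W2[of z] by (auto simp: a_def indicator_def intro!: ennreal_leI)
      qed
      finally have int: "ennreal (a * R k powr \<tau>) \<le> weighted_L2_norm_sq \<mu> K Q k s" .
      have "(W z)\<^sup>2 \<le> (W z0)\<^sup>2" using z0(2)[OF z] W0 by (intro power_mono) auto
      also have "(W z0)\<^sup>2 = a * (4 * exp (2 * real k * \<delta>))"
        by (simp add: a_def exp_minus)
      also have "\<dots> \<le> a * (C * exp (\<epsilon> * real k) * R k powr \<tau>)"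
        using mass_lower by (intro mult_left_mono) (auto simp: a_def)
      also have "\<dots> = C * exp (\<epsilon> * real k) * (a * R k powr \<tau>)" by simp
      finally have "ennreal ((W z)\<^sup>2) \<le> ennreal (C * exp (\<epsilon> * real k)) * ennreal (a * R k powr \<tau>)"
        using C by (subst ennreal_mult[symmetric]) (auto simp: a_def intro!: ennreal_leI)
      also have "\<dots> \<le> ennreal (C * exp (\<epsilon> * real k)) * weighted_L2_norm_sq \<mu> K Q k s"
        using int by (rule mult_left_mono) simp
      finally show ?thesis by (simp only: W2[OF z])
    qed
  qed
  show "\<exists>C>0. \<forall>k. \<forall>s\<in>polynomials_on k K.
      (SUP z\<in>K. ennreal ((cmod (s z))\<^sup>2 * exp (- 2 * real k * Q z)))
        \<le> ennreal (C * exp (\<epsilon> * real k)) * weighted_L2_norm_sq \<mu> K Q k s"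
    using C main by (intro exI[of _ C]) (auto intro!: SUP_least)
qed

section \<open>Continuously differentiable maps and charts\<close>

lemma Ck_on_imp_differentiable:
  "Ck_on (Suc k) S f \<Longrightarrow> x \<in> S \<Longrightarrow> (f has_derivative frechet_derivative f (at x)) (at x)"
  by (simp add: frechet_derivative_works)

lemma Ck_on_imp_continuous_on: "Ck_on k S f \<Longrightarrow> continuous_on S f"
  by (cases k) (auto intro!: continuous_at_imp_continuous_on differentiable_imp_continuous_within)

lemma Ck_on_subset: "Ck_on k S f \<Longrightarrow> T \<subseteq> S \<Longrightarrow> Ck_on k T f"
  by (induction k arbitrary: f) (auto intro: continuous_on_subset)

lemma Ck_on_cong:
  assumes "open S" "\<And>x. x \<in> S \<Longrightarrow> f x = g x" "Ck_on k S f"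
  shows "Ck_on k S g"
  using assms(2,3)
proof (induction k arbitrary: f g)
  case 0
  then show ?case by (auto cong: continuous_on_cong)
next
  case (Suc k)
  have D: "(g has_derivative frechet_derivative f (at x)) (at x)" if "x \<in> S" for x
    using Ck_on_imp_differentiable[OF Suc.prems(2) that] \<open>open S\<close> that Suc.prems(1)
    by (rule has_derivative_transform_within_open)
  have "frechet_derivative f (at x) v = frechet_derivative g (at x) v" if "x \<in> S" for x v
    using frechet_derivative_at[OF D[OF that]] by simp
  then have "Ck_on k S (\<lambda>x. frechet_derivative g (at x) v)" for v
    using Suc.IH[of "\<lambda>x. frechet_derivative f (at x) v" "\<lambda>x. frechet_derivative g (at x) v"]
      Suc.prems(2) by auto
  then show ?case using D by (auto simp: differentiable_def)
qed

lemma Ck_on_precompose_affine: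
  assumes "open T" "\<And>x. x \<in> T \<Longrightarrow> y + r *\<^sub>R x \<in> S" "Ck_on k S f"
  shows "Ck_on k T (\<lambda>x. f (y + r *\<^sub>R x))"
  using assms(3)
proof (induction k arbitrary: f)
  case 0
  then show ?case
    using assms(2) by (auto intro!: continuous_on_compose2[of S f] continuous_intros)
next
  case (Suc k)
  have D: "((\<lambda>x. f (y + r *\<^sub>R x)) has_derivative (\<lambda>v. frechet_derivative f (at (y + r *\<^sub>R x)) (r *\<^sub>R v))) (at x)"
    if "x \<in> T" for x
    by (rule has_derivative_compose[where g = f])
       (auto intro!: derivative_eq_intros Ck_on_imp_differentiable[OF Suc.prems] assms(2) that)
  have "Ck_on k T (\<lambda>x. frechet_derivative (\<lambda>x. f (y + r *\<^sub>R x)) (at x) v)" for v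
  proof (rule Ck_on_cong[OF \<open>open T\<close>])
    show "Ck_on k T (\<lambda>x. frechet_derivative f (at (y + r *\<^sub>R x)) (r *\<^sub>R v))"
      using Suc.IH[of "\<lambda>x. frechet_derivative f (at x) (r *\<^sub>R v)"] Suc.prems by auto
    show "frechet_derivative f (at (y + r *\<^sub>R x)) (r *\<^sub>R v) = frechet_derivative (\<lambda>x. f (y + r *\<^sub>R x)) (at x) v"
      if "x \<in> T" for x
      using frechet_derivative_at[OF D[OF that]] by (metis (no_types, lifting))
  qed
  then show ?case using D by (auto simp: differentiable_def)
qed

lemma Ck_on_postcompose_affine:
  assumes "open S" "Ck_on k S f"
  shows "Ck_on k S (\<lambda>x. c *\<^sub>R (f x - y))"
  using assms(2)
proof (induction k arbitrary: f y)
  case 0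
  then show ?case by (auto intro!: continuous_intros)
next
  case (Suc k)
  have D: "((\<lambda>x. c *\<^sub>R (f x - y)) has_derivative (\<lambda>v. c *\<^sub>R (frechet_derivative f (at x) v - 0))) (at x)"
    if "x \<in> S" for x
    using Ck_on_imp_differentiable[OF Suc.prems that] by (auto intro!: derivative_eq_intros)
  have "Ck_on k S (\<lambda>x. frechet_derivative (\<lambda>x. c *\<^sub>R (f x - y)) (at x) v)" for v
  proof (rule Ck_on_cong[OF \<open>open S\<close>])
    show "Ck_on k S (\<lambda>x. c *\<^sub>R (frechet_derivative f (at x) v - 0))"
      using Suc.IH[of "\<lambda>x. frechet_derivative f (at x) v" 0] Suc.prems by auto
    show "c *\<^sub>R (frechet_derivative f (at x) v - 0) = frechet_derivative (\<lambda>x. c *\<^sub>R (f x - y)) (at x) v"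
      if "x \<in> S" for x
      using frechet_derivative_at[OF D[OF that]] by (metis (no_types, lifting))
  qed
  then show ?case using D by (auto simp: differentiable_def)
qed

text \<open>
  The second directional derivatives along basis vectors are continuous, hence bounded on the ball,
  and the mean value inequality applies to each first directional derivative.
\<close>

lemma C2_derivative_Lipschitz:
  fixes f :: "'a::euclidean_space \<Rightarrow> 'b::euclidean_space"
  assumes f: "Ck_on (Suc (Suc k)) S f" and sub: "cball y r \<subseteq> S"
  obtains L where "L > 0"
    "\<And>x z v. x \<in> cball y r \<Longrightarrow> z \<in> cball y r \<Longrightarrow>
      norm (frechet_derivative f (at z) v - frechet_derivative f (at x) v) \<le> L * norm (z - x) * norm v"
proof -
  define D where "D b x = frechet_derivative f (at x) b" for b x
  define D2 where "D2 b c x = frechet_derivative (D b) (at x) c" for b c x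
  have DCk: "Ck_on (Suc k) S (D b)" for b using f unfolding D_def by simp
  have D: "(D b has_derivative (\<lambda>c. D2 b c x)) (at x)" if "x \<in> cball y r" for b x
    unfolding D2_def using Ck_on_imp_differentiable[OF DCk] sub that by auto
  have "\<exists>C. \<forall>x\<in>cball y r. norm (D2 b c x) \<le> C" for b c
  proof -
    have "continuous_on (cball y r) (D2 b c)"
    proof (rule continuous_on_subset[OF Ck_on_imp_continuous_on sub])
      show "Ck_on k S (D2 b c)" using DCk[of b] unfolding D2_def by simp
    qed
    then have "bounded (D2 b c ` cball y r)"
      by (intro compact_imp_bounded compact_continuous_image) auto
    then show ?thesis unfolding bounded_iff by auto
  qed
  then obtain C where C: "\<And>b c x. x \<in> cball y r \<Longrightarrow> norm (D2 b c x) \<le> C b c" by metis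
  define L where "L = 1 + (\<Sum>b\<in>Basis. \<Sum>c\<in>Basis. \<bar>C b c\<bar>)"
  have D_Lip: "norm (D b z - D b x) \<le> (\<Sum>c\<in>Basis. \<bar>C b c\<bar>) * norm (z - x)"
    if xz: "x \<in> cball y r" "z \<in> cball y r" for b x z
  proof (rule differentiable_bound[of "cball y r" "D b" "\<lambda>x c. D2 b c x"])
    fix u assume u: "u \<in> cball y r"
    then show "(D b has_derivative (\<lambda>c. D2 b c u)) (at u within cball y r)"
      using D has_derivative_at_withinI by blast
    have lin: "linear (\<lambda>c. D2 b c u)" using D[OF u] by (rule has_derivative_linear)
    show "onorm (\<lambda>c. D2 b c u) \<le> (\<Sum>c\<in>Basis. \<bar>C b c\<bar>)"
    proof (rule onorm_bound)
      fix v :: 'a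
      have "D2 b v u = (\<Sum>c\<in>Basis. (v \<bullet> c) *\<^sub>R D2 b c u)"
        by (subst (1) euclidean_representation[of v, symmetric])
           (simp add: linear_sum[OF lin] linear_scale[OF lin] del: euclidean_representation)
      also have "norm \<dots> \<le> (\<Sum>c\<in>Basis. norm v * \<bar>C b c\<bar>)"
        by (rule sum_norm_le) (use C[OF u] in \<open>auto intro!: mult_mono Basis_le_norm intro: order_trans[OF _ abs_ge_self]\<close>)
      finally show "norm (D2 b v u) \<le> (\<Sum>c\<in>Basis. \<bar>C b c\<bar>) * norm v"
        by (simp add: sum_distrib_left mult.commute)
    qed (auto intro: sum_nonneg)
  qed (use xz in auto)
  show thesis
  proof
    show "L > 0" unfolding L_def by (intro add_pos_nonneg sum_nonneg) auto
    fix x z v assume xz: "x \<in> cball y r" "z \<in> cball y r"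
    have lin: "linear (frechet_derivative f (at u))" if "u \<in> cball y r" for u
      using Ck_on_imp_differentiable[OF f] sub that by (blast intro: has_derivative_linear)
    have rep: "frechet_derivative f (at u) v = (\<Sum>b\<in>Basis. (v \<bullet> b) *\<^sub>R D b u)" if "u \<in> cball y r" for u
      unfolding D_def
      by (subst (1) euclidean_representation[of v, symmetric])
         (simp add: linear_sum[OF lin[OF that]] linear_scale[OF lin[OF that]] del: euclidean_representation)
    have "frechet_derivative f (at z) v - frechet_derivative f (at x) v = (\<Sum>b\<in>Basis. (v \<bullet> b) *\<^sub>R (D b z - D b x))"
      by (simp add: rep[OF xz(1)] rep[OF xz(2)] sum_subtractf algebra_simps)
    also have "norm \<dots> \<le> (\<Sum>b\<in>Basis. norm v * ((\<Sum>c\<in>Basis. \<bar>C b c\<bar>) * norm (z - x)))"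
      by (rule sum_norm_le) (use D_Lip[OF xz] in \<open>auto intro!: mult_mono Basis_le_norm\<close>)
    also have "\<dots> = (\<Sum>b\<in>Basis. \<Sum>c\<in>Basis. \<bar>C b c\<bar>) * norm (z - x) * norm v"
      by (simp add: sum_distrib_left sum_distrib_right mult_ac)
    also have "\<dots> \<le> L * norm (z - x) * norm v"
      by (intro mult_right_mono) (auto simp: L_def)
    finally show "norm (frechet_derivative f (at z) v - frechet_derivative f (at x) v) \<le> L * norm (z - x) * norm v" .
  qed
qed

lemma quadratic_error_of_Lipschitz_derivative:
  fixes f :: "'a::euclidean_space \<Rightarrow> 'b::euclidean_space"
  assumes f: "\<And>x. x \<in> S \<Longrightarrow> (f has_derivative f' x) (at x)" and S: "convex S"
    and L: "L \<ge> 0" "\<And>x z v. x \<in> S \<Longrightarrow> z \<in> S \<Longrightarrow> norm (f' z v - f' x v) \<le> L * norm (z - x) * norm v"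
    and xz: "x \<in> S" "z \<in> S"
  shows "norm (f z - (f x + f' x (z - x))) \<le> L * (norm (z - x))\<^sup>2"
proof -
  have seg: "closed_segment x z \<subseteq> S" using S xz by (simp add: closed_segment_subset)
  have lin: "linear (f' x)" using f[OF xz(1)] by (rule has_derivative_linear)
  have "norm ((f z - f' x z) - (f x - f' x x)) \<le> (L * norm (z - x)) * norm (z - x)"
  proof (rule differentiable_bound[of "closed_segment x z" "\<lambda>u. f u - f' x u" "\<lambda>u v. f' u v - f' x v"])
    fix u assume u: "u \<in> closed_segment x z"
    show "((\<lambda>u. f u - f' x u) has_derivative (\<lambda>v. f' u v - f' x v)) (at u within closed_segment x z)"
      using f[of u] seg u lin
      by (intro has_derivative_diff has_derivative_at_withinI[OF linear_imp_has_derivative])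
         (auto intro: has_derivative_at_withinI)
    show "onorm (\<lambda>v. f' u v - f' x v) \<le> L * norm (z - x)"
    proof (rule onorm_bound)
      fix v
      have "norm (f' u v - f' x v) \<le> L * norm (u - x) * norm v"
        using L(2)[of x u v] seg u xz by auto
      also have "\<dots> \<le> L * norm (z - x) * norm v"
        using segment_bound(1)[OF u] L(1) by (intro mult_right_mono mult_left_mono) auto
      finally show "norm (f' u v - f' x v) \<le> L * norm (z - x) * norm v" .
    qed (use L(1) in auto)
  qed auto
  then show ?thesis by (simp add: linear_diff[OF lin] power2_eq_square algebra_simps)
qed

lemma Ck_diffeomorphism_inverse:
  assumes "Ck_diffeomorphism k U V f"
  shows "x \<in> V \<Longrightarrow> inv_into U f x \<in> U" "x \<in> V \<Longrightarrow> f (inv_into U f x) = x"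
    "u \<in> U \<Longrightarrow> inv_into U f (f u) = u"
  using assms unfolding Ck_diffeomorphism_def bij_betw_def
  by (auto simp: inv_into_into f_inv_into_f)

lemma derivative_inverse_chart:
  assumes f: "Ck_diffeomorphism (Suc k) U V f" and y: "y \<in> V"
  shows "frechet_derivative (inv_into U f) (at y) (frechet_derivative f (at (inv_into U f y)) v) = v"
proof -
  let ?g = "inv_into U f"
  note inv = Ck_diffeomorphism_inverse[OF f]
  have "((\<lambda>x. ?g (f x)) has_derivative
      (\<lambda>v. frechet_derivative ?g (at y) (frechet_derivative f (at (?g y)) v))) (at (?g y))"
  proof (rule has_derivative_compose[where g = ?g])
    show "(f has_derivative frechet_derivative f (at (?g y))) (at (?g y))"
      by (rule Ck_on_imp_differentiable) (use f inv(1)[OF y] in \<open>auto simp: Ck_diffeomorphism_def\<close>)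
    show "(?g has_derivative frechet_derivative ?g (at y)) (at (f (?g y)))"
      unfolding inv(2)[OF y]
      by (rule Ck_on_imp_differentiable) (use f y in \<open>auto simp: Ck_diffeomorphism_def\<close>)
  qed
  then have "((\<lambda>x. x) has_derivative
      (\<lambda>v. frechet_derivative ?g (at y) (frechet_derivative f (at (?g y)) v))) (at (?g y))"
    by (rule has_derivative_transform_within_open[of _ _ _ _ U])
       (use f inv y in \<open>auto simp: Ck_diffeomorphism_def\<close>)
  then show ?thesis
    by (rule fun_cong[OF has_derivative_unique[OF _ has_derivative_ident]])
qed

lemma
  fixes f :: "'a::euclidean_space \<Rightarrow> 'a"
  assumes f: "Ck_diffeomorphism (Suc k) U V f" and y: "y \<in> V"
  shows linear_derivative_inverse_chart: "linear (frechet_derivative (inv_into U f) (at y))"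
    and inj_derivative_inverse_chart: "inj (frechet_derivative (inv_into U f) (at y))"
proof -
  show lin: "linear (frechet_derivative (inv_into U f) (at y))"
    by (rule has_derivative_linear, rule Ck_on_imp_differentiable)
       (use f y in \<open>auto simp: Ck_diffeomorphism_def\<close>)
  have "surj (frechet_derivative (inv_into U f) (at y))"
    using derivative_inverse_chart[OF f y] by (metis surjI)
  with lin show "inj (frechet_derivative (inv_into U f) (at y))"
    by (rule linear_surjective_imp_injective) (rule refl)
qed

section \<open>Convergence of subspaces\<close>

lemma
  fixes E :: "'a::euclidean_space set"
  assumes "subspace E"
  shows closest_point_in_subspace: "closest_point E x \<in> E"
    and closest_point_subspace_orthogonal: "v \<in> E \<Longrightarrow> v \<bullet> (x - closest_point E x) = 0"
proof -
  have E: "convex E" "closed E" "E \<noteq> {}"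
    using assms subspace_imp_convex closed_subspace subspace_0 by blast+
  show c: "closest_point E x \<in> E" using closest_point_in_set E by blast
  assume v: "v \<in> E"
  have "(x - closest_point E x) \<bullet> ((closest_point E x + w) - closest_point E x) \<le> 0" if "w \<in> E" for w
    using closest_point_dot[OF E(1,2)] subspace_add[OF assms c that] by blast
  from this[OF v] this[of "- v"] show "v \<bullet> (x - closest_point E x) = 0"
    using subspace_neg[OF assms v] by (simp add: inner_commute)
qed

lemma closest_point_subspace_eqI:
  fixes E :: "'a::euclidean_space set"
  assumes E: "subspace E" and c: "c \<in> E" "\<And>v. v \<in> E \<Longrightarrow> v \<bullet> (x - c) = 0"
  shows "closest_point E x = c"
proof -
  let ?p = "closest_point E x"
  have "c - ?p \<in> E" using E c(1) closest_point_in_subspace[OF E] by (simp add: subspace_diff)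
  then have "(c - ?p) \<bullet> (x - ?p) = 0" "(c - ?p) \<bullet> (x - c) = 0"
    using closest_point_subspace_orthogonal[OF E] c(2) by auto
  then have "(c - ?p) \<bullet> (c - ?p) = 0" by (simp add: inner_diff_right)
  then show ?thesis by simp
qed

lemma linear_closest_point_subspace:
  fixes E :: "'a::euclidean_space set"
  assumes E: "subspace E"
  shows "linear (closest_point E)"
proof (rule linearI)
  show "closest_point E (x + y) = closest_point E x + closest_point E y" for x y
    using closest_point_in_subspace[OF E] closest_point_subspace_orthogonal[OF E]
    by (intro closest_point_subspace_eqI[OF E])
       (auto simp: subspace_add[OF E] add_diff_add inner_add_right)
  show "closest_point E (c *\<^sub>R x) = c *\<^sub>R closest_point E x" for c x
    using closest_point_in_subspace[OF E] closest_point_subspace_orthogonal[OF E]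
    by (intro closest_point_subspace_eqI[OF E])
       (auto simp: subspace_mul[OF E] simp flip: scaleR_diff_right)
qed

lemma
  fixes E :: "'a::euclidean_space set"
  assumes E: "subspace E"
  shows norm_closest_point_subspace_le: "norm (closest_point E x) \<le> norm x"
    and norm_diff_closest_point_subspace_le: "norm (x - closest_point E x) \<le> norm x"
proof -
  have "orthogonal (closest_point E x) (x - closest_point E x)"
    using closest_point_subspace_orthogonal[OF E closest_point_in_subspace[OF E]]
    by (simp add: orthogonal_def)
  from norm_add_Pythagorean[OF this]
  have *: "(norm x)\<^sup>2 = (norm (closest_point E x))\<^sup>2 + (norm (x - closest_point E x))\<^sup>2" by simp
  show "norm (closest_point E x) \<le> norm x" "norm (x - closest_point E x) \<le> norm x"
    by (rule power2_le_imp_le; use * in simp)+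
qed

text \<open>
  With the orthogonal projections \<open>P\<close> and \<open>R\<close> onto \<open>E\<close> and \<open>F\<close>, the difference is
  \<open>P (1 - R) - (1 - P) R\<close>. The second term sees how far \<open>F\<close> is from \<open>E\<close>; the first is the adjoint of
  \<open>(1 - R) P\<close> and sees how far \<open>E\<close> is from \<open>F\<close>.
\<close>

lemma norm_diff_projections_le:
  fixes E F :: "'a::euclidean_space set"
  assumes E: "subspace E" and F: "subspace F" and \<epsilon>: "\<epsilon> \<ge> 0"
    and EF: "\<And>e. e \<in> E \<Longrightarrow> \<exists>f\<in>F. norm (e - f) \<le> \<epsilon> * norm e"
    and FE: "\<And>f. f \<in> F \<Longrightarrow> \<exists>e\<in>E. norm (f - e) \<le> \<epsilon> * norm f"
  shows "norm (closest_point F x - closest_point E x) \<le> 2 * \<epsilon> * norm x"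
proof -
  define f where "f = closest_point F x"
  define q where "q = x - f"
  define u where "u = closest_point E q"
  have f: "f \<in> F" "norm f \<le> norm x"
    unfolding f_def using closest_point_in_subspace[OF F] norm_closest_point_subspace_le[OF F] by auto
  have q: "norm q \<le> norm x" "\<And>v. v \<in> F \<Longrightarrow> v \<bullet> q = 0"
    unfolding q_def f_def
    using norm_diff_closest_point_subspace_le[OF F] closest_point_subspace_orthogonal[OF F] by auto
  have u: "u \<in> E" unfolding u_def by (rule closest_point_in_subspace[OF E])
  have "norm u \<le> \<epsilon> * norm q"
  proof (cases "u = 0")
    case False
    obtain g where g: "g \<in> F" "norm (u - g) \<le> \<epsilon> * norm u" using EF[OF u] by auto
    have "u \<bullet> (q - u) = 0"
      unfolding u_def by (rule closest_point_subspace_orthogonal[OF E closest_point_in_subspace[OF E]])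
    then have "norm u * norm u = (u - g) \<bullet> q"
      using q(2)[OF g(1)] by (simp add: inner_diff_left inner_diff_right flip: dot_square_norm power2_eq_square)
    also have "\<dots> \<le> norm (u - g) * norm q" by (rule norm_cauchy_schwarz)
    also have "\<dots> \<le> \<epsilon> * norm u * norm q" using g(2) by (rule mult_right_mono) simp
    finally have "norm u * norm u \<le> norm u * (\<epsilon> * norm q)" by (simp add: mult_ac)
    then show ?thesis using False by simp
  qed (use \<epsilon> in auto)
  also have "\<dots> \<le> \<epsilon> * norm x" using q(1) \<epsilon> by (rule mult_left_mono)
  finally have u_le: "norm u \<le> \<epsilon> * norm x" .
  obtain e where e: "e \<in> E" "norm (f - e) \<le> \<epsilon> * norm f" using FE[OF f(1)] by auto
  have "norm (f - closest_point E f) \<le> norm (f - e)"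
    using closest_point_le[OF closed_subspace[OF E] e(1), of f] by (simp add: dist_norm)
  also have "\<dots> \<le> \<epsilon> * norm x" using e(2) mult_left_mono[OF f(2) \<epsilon>] by linarith
  finally have f_le: "norm (f - closest_point E f) \<le> \<epsilon> * norm x" .
  have "closest_point E x = closest_point E q + closest_point E f"
    using linear_add[OF linear_closest_point_subspace[OF E], of q f] by (simp add: q_def)
  then have eq: "closest_point F x - closest_point E x = (f - closest_point E f) - u"
    by (simp add: u_def f_def)
  show ?thesis
    unfolding eq using norm_triangle_ineq4[of "f - closest_point E f" u] u_le f_le by linarith
qed

lemma subspaces_tendsto_linear_images:
  fixes G :: "nat \<Rightarrow> 'a::euclidean_space \<Rightarrow> 'b::euclidean_space"
  assumes V: "subspace V" and lin: "linear g" "\<And>j. linear (G j)"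
    and \<kappa>: "\<kappa> > 0" "\<And>v. v \<in> V \<Longrightarrow> \<kappa> * norm v \<le> norm (g v)"
    and \<eta>: "\<And>j v. norm (G j v - g v) \<le> \<eta> j * norm v" "\<eta> \<longlonglongrightarrow> 0"
  shows "subspaces_tendsto (\<lambda>j. G j ` V) (g ` V)"
proof -
  have sub: "subspace (g ` V)" "subspace (G j ` V)" for j
    using lin V by (auto intro: linear_subspace_image)
  let ?D = "\<lambda>j x. closest_point (G j ` V) x - closest_point (g ` V) x"
  have blin: "bounded_linear (?D j)" for j
    by (intro linear_conv_bounded_linear[THEN iffD1] linear_compose_sub
        linear_closest_point_subspace sub)
  have bound: "onorm (?D j) \<le> 2 * (2 * \<bar>\<eta> j\<bar> / \<kappa>)" if small: "\<bar>\<eta> j\<bar> < \<kappa> / 2" for j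
  proof (rule onorm_bound)
    have \<eta>': "norm (G j v - g v) \<le> \<bar>\<eta> j\<bar> * norm v" for v
      using \<eta>(1)[of j v] by (rule order_trans) (simp add: mult_right_mono)
    show "norm (?D j x) \<le> 2 * (2 * \<bar>\<eta> j\<bar> / \<kappa>) * norm x" for x
    proof (rule norm_diff_projections_le[OF sub])
      show "2 * \<bar>\<eta> j\<bar> / \<kappa> \<ge> 0" using \<kappa>(1) by simp
      show "\<exists>f\<in>G j ` V. norm (e - f) \<le> 2 * \<bar>\<eta> j\<bar> / \<kappa> * norm e" if e: "e \<in> g ` V" for e
      proof -
        obtain v where v: "v \<in> V" "e = g v" using e by auto
        have "norm (e - G j v) \<le> \<bar>\<eta> j\<bar> * norm v" using \<eta>'[of v] by (simp add: v norm_minus_commute)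
        also have "\<dots> \<le> \<bar>\<eta> j\<bar> * (norm e / \<kappa>)"
          using \<kappa> v by (intro mult_left_mono) (auto simp: field_simps)
        also have "\<dots> \<le> 2 * \<bar>\<eta> j\<bar> / \<kappa> * norm e" using \<kappa>(1) by (simp add: field_simps)
        finally show ?thesis using v(1) by blast
      qed
      show "\<exists>e\<in>g ` V. norm (f - e) \<le> 2 * \<bar>\<eta> j\<bar> / \<kappa> * norm f" if f: "f \<in> G j ` V" for f
      proof -
        obtain v where v: "v \<in> V" "f = G j v" using f by auto
        have "\<kappa> * norm v \<le> norm f + \<bar>\<eta> j\<bar> * norm v"
          using \<kappa>(2)[OF v(1)] \<eta>'[of v] norm_triangle_sub[of "g v" "G j v"]
          by (simp add: v norm_minus_commute)
        also have "\<bar>\<eta> j\<bar> * norm v \<le> \<kappa> / 2 * norm v"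
          using small by (intro mult_right_mono) auto
        finally have "norm v \<le> 2 * norm f / \<kappa>" using \<kappa>(1) by (simp add: field_simps)
        then have "\<bar>\<eta> j\<bar> * norm v \<le> \<bar>\<eta> j\<bar> * (2 * norm f / \<kappa>)" by (rule mult_left_mono) simp
        then have "norm (f - g v) \<le> 2 * \<bar>\<eta> j\<bar> / \<kappa> * norm f"
          using \<eta>'[of v] by (simp add: v mult_ac)
        then show ?thesis using v(1) by blast
      qed
    qed
  qed (use \<kappa>(1) in auto)
  have "eventually (\<lambda>j. \<bar>\<eta> j\<bar> < \<kappa> / 2) sequentially"
    using tendsto_rabs[OF \<eta>(2)] \<kappa>(1) by (intro order_tendstoD) auto
  then have "eventually (\<lambda>j. onorm (?D j) \<le> 2 * (2 * \<bar>\<eta> j\<bar> / \<kappa>)) sequentially"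
    by eventually_elim (rule bound)
  moreover have "(\<lambda>j. 2 * (2 * \<bar>\<eta> j\<bar> / \<kappa>)) \<longlonglongrightarrow> 2 * (2 * \<bar>0\<bar> / \<kappa>)"
    by (intro tendsto_intros \<eta>) (use \<kappa>(1) in auto)
  ultimately have "(\<lambda>j. onorm (?D j)) \<longlonglongrightarrow> 0"
    by (intro real_tendsto_sandwich[of "\<lambda>_. 0" "\<lambda>j. onorm (?D j)" sequentially])
       (auto simp: onorm_pos_le[OF blin])
  then show ?thesis using sub unfolding subspaces_tendsto_def by blast
qed

section \<open>Regular points and genericity\<close>

text \<open>The inner products of \<open>g\<close> with the vectors normal to \<open>V\<close> are locally constant.\<close>

lemma derivative_in_subspace:
  fixes V :: "'a::euclidean_space set"
  assumes V: "subspace V" and g: "(g has_vector_derivative v) (at t)"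
    and ev: "eventually (\<lambda>u. g u - y \<in> V) (nhds t)"
  shows "v \<in> V"
proof -
  obtain a b where ab: "a \<in> span V" "\<And>w. w \<in> span V \<Longrightarrow> orthogonal b w" "v = a + b"
    using orthogonal_subspace_decomp_exists[of V v] by metis
  have "((\<lambda>u. b \<bullet> (g u - y)) has_vector_derivative b \<bullet> v) (at t)"
    using has_vector_derivative_diff[OF g has_vector_derivative_const[of y]]
    by (auto intro: bounded_linear.has_vector_derivative[OF bounded_linear_inner_right])
  moreover have "eventually (\<lambda>u. b \<bullet> (g u - y) = 0) (nhds t)"
    using ev by eventually_elim (use ab(2) in \<open>auto simp: orthogonal_def span_base\<close>)
  then have "((\<lambda>u. b \<bullet> (g u - y)) has_vector_derivative 0) (at t) \<longleftrightarrow> ((\<lambda>u. 0 :: real) has_vector_derivative 0) (at t)"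
    by (intro has_vector_derivative_cong_ev) (auto dest: eventually_nhds_x_imp_x elim: eventually_mono)
  then have "((\<lambda>u. b \<bullet> (g u - y)) has_vector_derivative 0) (at t)" by simp
  ultimately have "b \<bullet> v = 0" by (rule vector_derivative_unique_at)
  moreover have "b \<bullet> a = 0" using ab(1,2) by (simp add: orthogonal_def)
  ultimately have "b = 0" using ab(3) by (simp add: inner_add_right)
  then show ?thesis using ab(1,3) V by (metis add.right_neutral span_eq_iff)
qed

text \<open>
  Where the model is an affine subspace, restricting the chart to a small ball and rescaling that
  ball to the unit ball gives a chart that shows regularity. The chart and its inverse transport
  the velocities of curves in both directions.
\<close>

lemma
  fixes \<Psi> :: "'a::euclidean_space \<Rightarrow> 'a" and K V W :: "'a set"
  assumes chart: "Ck_diffeomorphism (Suc k) W (ball 0 1) \<Psi>"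
    and r: "r > 0" "ball y r \<subseteq> ball 0 1" and V: "subspace V" "dim V = m"
    and flat: "\<And>x. x \<in> ball y r \<Longrightarrow> x \<in> \<Psi> ` (K \<inter> W) \<longleftrightarrow> x - y \<in> V"
  shows regular_point_of_flat_chart: "regular_point (Suc k) m K (inv_into W \<Psi> y)"
    and tangent_space_of_flat_chart:
      "tangent_space K (inv_into W \<Psi> y) = frechet_derivative (inv_into W \<Psi>) (at y) ` V"
proof -
  define \<Phi> where "\<Phi> = inv_into W \<Psi>"
  have W: "open W" and bij: "bij_betw \<Psi> W (ball 0 1)" and \<Psi>: "Ck_on (Suc k) W \<Psi>"
    and \<Phi>: "Ck_on (Suc k) (ball 0 1) \<Phi>"
    using chart unfolding Ck_diffeomorphism_def \<Phi>_def by auto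
  note \<Phi>W = Ck_diffeomorphism_inverse(1)[OF chart, folded \<Phi>_def]
    and \<Psi>\<Phi> = Ck_diffeomorphism_inverse(2)[OF chart, folded \<Phi>_def]
    and \<Phi>\<Psi> = Ck_diffeomorphism_inverse(3)[OF chart, folded \<Phi>_def]
  have y: "y \<in> ball y r" "y \<in> ball 0 1" using r by (auto simp: subset_iff)
  have K\<Phi>: "\<Phi> x \<in> K \<longleftrightarrow> x - y \<in> V" if "x \<in> ball y r" for x
  proof -
    have "x \<in> ball 0 1" using that r(2) by blast
    then have "\<Phi> x \<in> W" "\<Psi> (\<Phi> x) = x" by (simp_all add: \<Phi>W \<Psi>\<Phi> del: mem_ball)
    then have "\<Phi> x \<in> K \<longleftrightarrow> x \<in> \<Psi> ` (K \<inter> W)"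
      using \<Phi>\<Psi> by force
    then show ?thesis using flat[OF that] by simp
  qed
  define W' where "W' = W \<inter> \<Psi> -` ball y r"
  have W': "open W'"
    unfolding W'_def using Ck_on_imp_continuous_on[OF \<Psi>] W by (intro continuous_open_preimage) auto
  define \<Psi>' where "\<Psi>' x = (1 / r) *\<^sub>R (\<Psi> x - y)" for x
  have in_ball: "y + r *\<^sub>R u \<in> ball y r" if "u \<in> ball 0 1" for u
    using that r(1) by (simp add: dist_norm)
  have \<Phi>W': "\<Phi> (y + r *\<^sub>R u) \<in> W'" if "u \<in> ball 0 1" for u
    using in_ball[OF that] \<Phi>W \<Psi>\<Phi> r(2) unfolding W'_def by (auto simp del: mem_ball)
  have \<Psi>'\<Phi>: "\<Psi>' (\<Phi> (y + r *\<^sub>R u)) = u" if "u \<in> ball 0 1" for u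
    using \<Psi>\<Phi>[of "y + r *\<^sub>R u"] in_ball[OF that] r unfolding \<Psi>'_def by (simp add: subset_iff)
  have \<Psi>'_ball: "\<Psi>' x \<in> ball 0 1" if "x \<in> W'" for x
    using that r(1) unfolding W'_def \<Psi>'_def by (simp add: dist_norm norm_minus_commute)
  have unscale: "y + r *\<^sub>R \<Psi>' x = \<Psi> x" for x using r(1) by (simp add: \<Psi>'_def)
  have bij': "bij_betw \<Psi>' W' (ball 0 1)"
    by (rule bij_betw_byWitness[where f' = "\<lambda>u. \<Phi> (y + r *\<^sub>R u)"])
       (use \<Phi>\<Psi> \<Psi>'\<Phi> \<Psi>'_ball \<Phi>W' unscale in \<open>auto simp: W'_def simp del: mem_ball\<close>)
  have inv': "inv_into W' \<Psi>' u = \<Phi> (y + r *\<^sub>R u)" if "u \<in> ball 0 1" for u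
    using bij' \<Phi>W'[OF that] \<Psi>'\<Phi>[OF that] by (intro inv_into_f_eq) (auto simp: bij_betw_def)
  have "Ck_on (Suc k) (ball 0 1) (inv_into W' \<Psi>')"
  proof (rule Ck_on_cong)
    show "Ck_on (Suc k) (ball 0 1) (\<lambda>u. \<Phi> (y + r *\<^sub>R u))"
      by (rule Ck_on_precompose_affine[OF _ _ \<Phi>]) (use in_ball r(2) in \<open>simp, blast\<close>)
  qed (use inv' in auto)
  moreover have "Ck_on (Suc k) W' \<Psi>'"
    unfolding \<Psi>'_def by (intro Ck_on_postcompose_affine[OF W'] Ck_on_subset[OF \<Psi>]) (auto simp: W'_def)
  moreover have "\<Phi> y \<in> W'" using \<Phi>W'[of 0] by simp
  ultimately have "unit_ball_chart_at (Suc k) (\<Phi> y) W' \<Psi>'"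
    using W' bij' unfolding unit_ball_chart_at_def Ck_diffeomorphism_def by auto
  moreover have "\<Psi>' ` (K \<inter> W') = ball 0 1 \<inter> V"
  proof (intro equalityI subsetI)
    fix u assume "u \<in> \<Psi>' ` (K \<inter> W')"
    then obtain x where x: "x \<in> K" "x \<in> W'" "u = \<Psi>' x" by auto
    then have "\<Psi> x - y \<in> V" using flat[of "\<Psi> x"] by (auto simp: W'_def)
    then have "u \<in> V" unfolding x(3) \<Psi>'_def by (rule subspace_mul[OF V(1)])
    then show "u \<in> ball 0 1 \<inter> V" using \<Psi>'_ball x by blast
  next
    fix u assume u: "u \<in> ball 0 1 \<inter> V"
    then have "(y + r *\<^sub>R u) - y \<in> V" by (simp add: subspace_mul[OF V(1)])
    then have "\<Phi> (y + r *\<^sub>R u) \<in> K" using K\<Phi> in_ball u by blast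
    then show "u \<in> \<Psi>' ` (K \<inter> W')" using \<Psi>'\<Phi>[of u] \<Phi>W'[of u] u by (metis IntD1 IntI image_eqI)
  qed
  moreover have "\<Phi> y \<in> K" using K\<Phi>[OF y(1)] V(1) by (simp add: subspace_0)
  ultimately show "regular_point (Suc k) m K (inv_into W \<Psi> y)"
    using V unfolding regular_point_def \<Phi>_def by blast
  have D\<Phi>: "(\<Phi> has_derivative frechet_derivative \<Phi> (at y)) (at y)"
    by (rule Ck_on_imp_differentiable[OF \<Phi> y(2)])
  define \<Psi>d where "\<Psi>d = frechet_derivative \<Psi> (at (\<Phi> y))"
  have D\<Psi>: "(\<Psi> has_derivative \<Psi>d) (at (\<Phi> y))"
    unfolding \<Psi>d_def by (rule Ck_on_imp_differentiable[OF \<Psi> \<Phi>W[OF y(2)]])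
  have inverse: "frechet_derivative \<Phi> (at y) (\<Psi>d v) = v" for v
    unfolding \<Phi>_def \<Psi>d_def by (rule derivative_inverse_chart[OF chart y(2)])
  have "tangent_space K (\<Phi> y) = frechet_derivative \<Phi> (at y) ` V"
  proof (intro equalityI subsetI)
    fix v assume "v \<in> tangent_space K (\<Phi> y)"
    then obtain \<gamma> e where \<gamma>: "e > 0" "\<forall>t\<in>{-e<..<e}. \<gamma> t \<in> K" "\<gamma> 0 = \<Phi> y"
        "(\<gamma> has_vector_derivative v) (at (0::real))"
      unfolding tangent_space_def by blast
    have "((\<lambda>t. \<Psi> (\<gamma> t)) has_derivative (\<lambda>h. \<Psi>d (h *\<^sub>R v))) (at 0)"
      using has_derivative_compose[OF \<gamma>(4)[unfolded has_vector_derivative_def], of \<Psi> \<Psi>d] D\<Psi>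
      by (simp add: \<gamma>(3))
    then have "((\<lambda>t. \<Psi> (\<gamma> t)) has_vector_derivative \<Psi>d v) (at 0)"
      unfolding has_vector_derivative_def
      by (simp add: linear_scale[OF has_derivative_linear[OF D\<Psi>]])
    moreover have "eventually (\<lambda>t. \<Psi> (\<gamma> t) - y \<in> V) (nhds 0)"
    proof -
      have "isCont \<gamma> 0" using \<gamma>(4) by (rule has_vector_derivative_continuous)
      then have "(\<gamma> \<longlongrightarrow> \<Phi> y) (nhds 0)"
        using \<gamma>(3) by (simp add: isCont_def tendsto_nhds_iff)
      then have "eventually (\<lambda>t. \<gamma> t \<in> W') (nhds 0)"
        using topological_tendstoD[OF _ W'] \<open>\<Phi> y \<in> W'\<close> by blast
      moreover have "eventually (\<lambda>t. t \<in> {-e<..<e}) (nhds 0)"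
        using \<gamma>(1) by (intro eventually_nhds_in_open) auto
      ultimately show ?thesis
      proof eventually_elim
        case (elim t)
        then show ?case using \<gamma>(2) flat[of "\<Psi> (\<gamma> t)"] unfolding W'_def by blast
      qed
    qed
    ultimately have "\<Psi>d v \<in> V" by (intro derivative_in_subspace[OF V(1)])
    then show "v \<in> frechet_derivative \<Phi> (at y) ` V" using inverse by (metis image_eqI)
  next
    fix w assume "w \<in> frechet_derivative \<Phi> (at y) ` V"
    then obtain v where v: "v \<in> V" "w = frechet_derivative \<Phi> (at y) v" by auto
    define e where "e = r / (norm v + 1)"
    have e: "e > 0" using r(1) by (simp add: e_def add_nonneg_pos)
    have "\<Phi> (y + t *\<^sub>R v) \<in> K" if "t \<in> {-e<..<e}" for t
    proof -
      have "norm (t *\<^sub>R v) \<le> \<bar>t\<bar> * (norm v + 1)" by (simp add: mult_left_mono)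
      also have "\<dots> < e * (norm v + 1)"
        using that by (intro mult_strict_right_mono) (auto simp: add_nonneg_pos)
      also have "\<dots> = r" by (simp add: e_def add_nonneg_eq_0_iff)
      finally have "y + t *\<^sub>R v \<in> ball y r" by (simp add: dist_norm)
      then show ?thesis using K\<Phi> v(1) by (simp add: subspace_mul[OF V(1)] del: mem_ball)
    qed
    moreover have "((\<lambda>t. \<Phi> (y + t *\<^sub>R v)) has_vector_derivative w) (at 0)"
    proof -
      have "((\<lambda>t. \<Phi> (y + t *\<^sub>R v)) has_derivative (\<lambda>h. frechet_derivative \<Phi> (at y) (h *\<^sub>R v))) (at 0)"
        by (rule has_derivative_compose[where g = \<Phi>]) (auto intro!: derivative_eq_intros D\<Phi>)
      then show ?thesis unfolding has_vector_derivative_def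
        by (simp add: linear_scale[OF has_derivative_linear[OF D\<Phi>]] v(2))
    qed
    ultimately show "w \<in> tangent_space K (\<Phi> y)"
      unfolding tangent_space_def using e
      by (intro CollectI exI[of _ "\<lambda>t. \<Phi> (y + t *\<^sub>R v)"] exI[of _ e]) auto
  qed
  then show "tangent_space K (inv_into W \<Psi> y) = frechet_derivative (inv_into W \<Psi>) (at y) ` V"
    by (simp add: \<Phi>_def)
qed

text \<open>
  A nonempty relatively open subset of the affine hull of \<open>P\<close> generates that affine hull, so no single
  \<open>A\<close> contains it, and after the removal of \<open>A\<close> it is again nonempty and relatively open.
\<close>

lemma openin_affine_hull_avoid_affine:
  fixes P :: "'a::euclidean_space set"
  assumes "finite \<B>" "\<And>A. A \<in> \<B> \<Longrightarrow> affine A \<and> \<not> affine hull P \<subseteq> A"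
    and "openin (top_of_set (affine hull P)) U" "U \<noteq> {}"
  shows "\<exists>y\<in>U. y \<notin> \<Union>\<B>"
  using assms
proof (induction \<B> arbitrary: U rule: finite_induct)
  case (insert A \<B>)
  have "\<not> U \<subseteq> A"
  proof
    assume "U \<subseteq> A"
    moreover have "affine hull U = affine hull P"
      by (rule affine_hull_openin) (use insert.prems in auto)
    ultimately show False using insert.prems(1)[of A] by (metis hull_minimal insertI1)
  qed
  moreover have "openin (top_of_set (affine hull P)) (U - A)"
  proof -
    have "open (- A)" using insert.prems(1)[of A] by (simp add: affine_closed flip: closed_def)
    then have "openin (top_of_set (affine hull P)) (U \<inter> - A)"
      by (rule openin_Int_open[OF insert.prems(2)])
    then show ?thesis by (simp add: Diff_eq)
  qed
  ultimately obtain y where "y \<in> U - A" "y \<notin> \<Union>\<B>"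
    using insert.IH[of "U - A"] insert.prems(1) by blast
  then show ?case by auto
qed auto

text \<open>
  A point of the relative interior of \<open>P\<close> that lies on none of the other affine hulls has a
  neighbourhood in which \<open>\<Union>F\<close> is the affine hull of \<open>P\<close>. Such points are dense in \<open>P\<close> because, all
  dimensions being equal, none of the other affine hulls contains the one of \<open>P\<close>.
\<close>

lemma flat_points_dense_in_polyhedron:
  fixes F :: "'a::euclidean_space set set"
  assumes F: "finite F" "\<And>P. P \<in> F \<Longrightarrow> polyhedron P \<and> aff_dim P = int m"
    and P: "P \<in> F" and y: "y \<in> P" "y \<in> ball 0 1" and \<epsilon>: "\<epsilon> > 0"
  obtains x r where "dist y x < \<epsilon>" "x \<in> ball 0 1" "r > 0" "ball x r \<subseteq> ball 0 1"
    "\<And>z. z \<in> ball x r \<Longrightarrow> z \<in> ball 0 1 \<inter> \<Union>F \<longleftrightarrow> z - x \<in> span ((\<lambda>x. - y + x) ` P)"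
proof -
  let ?V = "span ((\<lambda>x. - y + x) ` P)"
  have hull: "affine hull P = (+) y ` ?V"
    by (rule affine_hull_span_gen) (simp add: y(1) hull_inc)
  have hull_iff: "z \<in> affine hull P \<longleftrightarrow> z - y \<in> ?V" for z
    unfolding hull by (force simp: image_iff)
  define U where "U = rel_interior P \<inter> (ball y \<epsilon> \<inter> ball 0 1)"
  have "convex P" using F(2)[OF P] by (simp add: polyhedron_imp_convex)
  then have "y \<in> closure (rel_interior P)"
    using y(1) closure_subset[of P] by (auto simp: convex_closure_rel_interior)
  moreover have "y \<in> ball y \<epsilon> \<inter> ball 0 1" using y(2) \<epsilon> by simp
  ultimately have "ball y \<epsilon> \<inter> ball 0 1 \<inter> closure (rel_interior P) \<noteq> {}" by blast
  then have "U \<noteq> {}"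
    unfolding U_def using open_Int_closure_eq_empty[of "ball y \<epsilon> \<inter> ball 0 1" "rel_interior P"]
    by (auto simp: open_Int)
  moreover have "openin (top_of_set (affine hull P)) U"
    unfolding U_def by (intro openin_Int_open openin_rel_interior open_Int open_ball)
  moreover define \<B> where "\<B> = {affine hull P' |P'. P' \<in> F \<and> affine hull P' \<noteq> affine hull P}"
  have fin: "finite \<B>" using F(1) by (simp add: \<B>_def)
  have "affine A \<and> \<not> affine hull P \<subseteq> A" if A: "A \<in> \<B>" for A
  proof -
    obtain P' where P': "P' \<in> F" "affine hull P' \<noteq> affine hull P" "A = affine hull P'"
      using A unfolding \<B>_def by auto
    have "affine hull P = affine hull P'" if "affine hull P \<subseteq> affine hull P'"
      by (rule affine_dim_equal) (use that F(2) P P'(1) y(1) in auto)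
    then show ?thesis using P' by auto
  qed
  ultimately obtain x where x: "x \<in> U" "x \<notin> \<Union>\<B>"
    using openin_affine_hull_avoid_affine[OF fin, of P U] by blast
  obtain e1 where e1: "e1 > 0" "ball x e1 \<inter> affine hull P \<subseteq> P"
    using x(1) unfolding U_def by (auto simp: mem_rel_interior_ball)
  have "closed (\<Union>\<B>)" using fin by (intro closed_Union) (auto simp: \<B>_def)
  then obtain e2 where e2: "e2 > 0" "ball x e2 \<subseteq> - \<Union>\<B>"
    using x(2) open_contains_ball[of "- \<Union>\<B>"] by (meson ComplI open_Compl)
  obtain e3 where e3: "e3 > 0" "ball x e3 \<subseteq> ball 0 1"
    using x(1) open_contains_ball[of "ball 0 1 :: 'a set"] unfolding U_def by (meson IntE open_ball)
  have xP: "x \<in> affine hull P" using x(1) rel_interior_subset[of P] hull_subset[of P affine]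
    unfolding U_def by blast
  show thesis
  proof (rule that)
    show "dist y x < \<epsilon>" "x \<in> ball 0 1" using x(1) unfolding U_def by auto
    show "min e1 (min e2 e3) > 0" using e1 e2 e3 by simp
    show "ball x (min e1 (min e2 e3)) \<subseteq> ball 0 1" using e3(2) by auto
    show "z \<in> ball 0 1 \<inter> \<Union>F \<longleftrightarrow> z - x \<in> ?V" if z: "z \<in> ball x (min e1 (min e2 e3))" for z
    proof -
      have "x - y \<in> ?V" using xP hull_iff by blast
      then have "z - x \<in> ?V \<longleftrightarrow> z - y \<in> ?V"
        using span_add[of "z - x" _ "x - y"] span_diff[of "z - y" _ "x - y"] by auto
      also have "\<dots> \<longleftrightarrow> z \<in> affine hull P" by (simp add: hull_iff)
      also have "\<dots> \<longleftrightarrow> z \<in> ball 0 1 \<inter> \<Union>F"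
      proof
        assume "z \<in> affine hull P"
        then show "z \<in> ball 0 1 \<inter> \<Union>F" using z e1(2) e3(2) P by auto
      next
        assume zF: "z \<in> ball 0 1 \<inter> \<Union>F"
        then obtain P' where P': "P' \<in> F" "z \<in> P'" by auto
        have "z \<notin> \<Union>\<B>" using e2(2) z by auto
        then have "affine hull P' = affine hull P"
          using P' hull_inc[of z P' affine] unfolding \<B>_def by blast
        then show "z \<in> affine hull P" using P'(2) hull_inc by metis
      qed
      finally show ?thesis by simp
    qed
  qed
qed

text \<open>
  At regular points near \<open>p\<close> that come from the relative interior of \<open>P\<close>, the tangent space is the
  image of the direction of \<open>P\<close> under the derivative of the inverse chart. By continuity of that
  derivative these tangent spaces converge to the corresponding image at \<open>p\<close>, and genericity
  applies to the limit.
\<close>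

lemma generic_directions_of_polyhedron:
  fixes K :: "(complex ^ 'n) set" and \<Psi> :: "complex ^ 'n \<Rightarrow> complex ^ 'n"
  assumes gen: "CR_generic (Suc (Suc k)) m K" and p: "p \<in> K"
    and chart: "unit_ball_chart_at (Suc (Suc k)) p W \<Psi>"
    and F: "finite F" "\<And>P. P \<in> F \<Longrightarrow> polyhedron P \<and> aff_dim P = int m"
    and image: "\<Psi> ` (K \<inter> W) = ball 0 1 \<inter> \<Union>F"
    and P: "P \<in> F" "\<Psi> p \<in> P"
  defines "E \<equiv> frechet_derivative (inv_into W \<Psi>) (at (\<Psi> p)) ` span ((\<lambda>x. - \<Psi> p + x) ` P)"
  shows "E + complex_structure ` E = UNIV"
proof -
  define \<Phi> where "\<Phi> = inv_into W \<Psi>"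
  define y where "y = \<Psi> p"
  define V where "V = span ((\<lambda>x. - y + x) ` P)"
  have diffeo: "Ck_diffeomorphism (Suc (Suc k)) W (ball 0 1) \<Psi>" and pW: "p \<in> W"
    using chart unfolding unit_ball_chart_at_def by auto
  have \<Phi>: "Ck_on (Suc (Suc k)) (ball 0 1) \<Phi>" using diffeo unfolding Ck_diffeomorphism_def \<Phi>_def by simp
  have y: "y \<in> ball 0 1" "y \<in> P"
    using image p pW P(2) unfolding y_def by auto
  have \<Phi>y: "\<Phi> y = p" unfolding \<Phi>_def y_def by (rule Ck_diffeomorphism_inverse(3)[OF diffeo pW])
  have dimV: "dim V = m"
    using aff_dim_eq_dim[of y P] F(2)[OF P(1)] y(2) by (simp add: V_def dim_span hull_inc)
  obtain R where R: "R > 0" "cball y R \<subseteq> ball 0 1"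
    using y(1) open_contains_cball[of "ball 0 1 :: (complex ^ 'n) set"] by (meson open_ball)
  obtain L where L: "L > 0"
    "\<And>x z v. x \<in> cball y R \<Longrightarrow> z \<in> cball y R \<Longrightarrow>
      norm (frechet_derivative \<Phi> (at z) v - frechet_derivative \<Phi> (at x) v) \<le> L * norm (z - x) * norm v"
    using C2_derivative_Lipschitz[OF \<Phi> R(2)] by blast
  have "\<exists>x r. dist y x < R / (real j + 1) \<and> x \<in> ball 0 1 \<and> r > 0 \<and> ball x r \<subseteq> ball 0 1 \<and>
      (\<forall>z\<in>ball x r. z \<in> ball 0 1 \<inter> \<Union>F \<longleftrightarrow> z - x \<in> V)" for j :: nat
  proof -
    have "R / (real j + 1) > 0" using R(1) by simp
    from flat_points_dense_in_polyhedron[OF F P(1) y(2,1) this]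
    show ?thesis unfolding V_def by metis
  qed
  then obtain x r where x: "\<And>j. dist y (x j) < R / (real j + 1)" "\<And>j. x j \<in> ball 0 1"
    and r: "\<And>j. r j > 0" "\<And>j. ball (x j) (r j) \<subseteq> ball 0 1"
      "\<And>j z. z \<in> ball (x j) (r j) \<Longrightarrow> z \<in> ball 0 1 \<inter> \<Union>F \<longleftrightarrow> z - x j \<in> V"
    by metis
  have subV: "subspace V" by (simp add: V_def)
  have flat: "z \<in> \<Psi> ` (K \<inter> W) \<longleftrightarrow> z - x j \<in> V" if "z \<in> ball (x j) (r j)" for j z
    unfolding image by (rule r(3)[OF that])
  have regular: "regular_point (Suc (Suc k)) m K (\<Phi> (x j))"
    and tangent: "tangent_space K (\<Phi> (x j)) = frechet_derivative \<Phi> (at (x j)) ` V" for j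
    unfolding \<Phi>_def
    using regular_point_of_flat_chart[OF diffeo r(1,2) subV dimV flat]
      tangent_space_of_flat_chart[OF diffeo r(1,2) subV dimV flat] by auto
  have "(\<lambda>j. R / (real j + 1)) \<longlonglongrightarrow> 0"
    using LIMSEQ_Suc[OF lim_const_over_n[of R]] by (simp add: add.commute)
  then have "(\<lambda>j. dist (x j) y) \<longlonglongrightarrow> 0"
    by (rule tendsto_sandwich[OF _ _ tendsto_const, rotated 2])
       (use x(1) in \<open>auto simp: dist_commute less_imp_le\<close>)
  then have xy: "x \<longlonglongrightarrow> y" by (rule tendsto_dist_iff[THEN iffD2])
  have "isCont \<Phi> y"
    using Ck_on_imp_continuous_on[OF \<Phi>] y(1) by (simp add: continuous_on_eq_continuous_at)
  then have lim: "(\<lambda>j. \<Phi> (x j)) \<longlonglongrightarrow> p"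
    using isCont_tendsto_compose[OF _ xy] \<Phi>y by metis
  note lin = linear_derivative_inverse_chart[OF diffeo, folded \<Phi>_def]
  obtain \<kappa> where \<kappa>: "\<kappa> > 0" "\<And>v. \<kappa> * norm v \<le> norm (frechet_derivative \<Phi> (at y) v)"
    using linear_inj_bounded_below_pos[OF lin[OF y(1)]
        inj_derivative_inverse_chart[OF diffeo y(1), folded \<Phi>_def]] by auto
  have xR: "x j \<in> cball y R" for j
  proof -
    have "R / (real j + 1) \<le> R / 1" using R(1) by (intro divide_left_mono) auto
    then show ?thesis using x(1)[of j] by simp
  qed
  have "subspaces_tendsto (\<lambda>j. frechet_derivative \<Phi> (at (x j)) ` V) (frechet_derivative \<Phi> (at y) ` V)"
  proof (rule subspaces_tendsto_linear_images[OF subV lin[OF y(1)] lin[OF x(2)] \<kappa>])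
    show "norm (frechet_derivative \<Phi> (at (x j)) v - frechet_derivative \<Phi> (at y) v)
        \<le> (L * norm (x j - y)) * norm v" for j v
      using L(2)[OF _ xR] R(1) by simp
    have "(\<lambda>j. L * norm (x j - y)) \<longlonglongrightarrow> L * norm (y - y)"
      by (intro tendsto_intros xy)
    then show "(\<lambda>j. L * norm (x j - y)) \<longlonglongrightarrow> 0" by simp
  qed
  then have "subspaces_tendsto (\<lambda>j. tangent_space K (\<Phi> (x j))) E"
    unfolding tangent E_def by (simp add: \<Phi>_def V_def y_def)
  then show ?thesis
    using gen p regular lim unfolding CR_generic_def
    by (elim ballE allE[of _ "\<lambda>j. \<Phi> (x j)"]) auto
qed

section \<open>Complex bases\<close>

lemma of_real_vector_scalar_mult:
  fixes v :: "complex ^ 'n"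
  shows "of_real x *s v = x *\<^sub>R v"
  by (simp add: vec_eq_iff) (simp add: scaleR_conv_of_real)

lemma linear_complex_combination:
  fixes e :: "'n::finite \<Rightarrow> complex ^ 'm"
  shows "linear (\<lambda>w :: complex ^ 'n. \<Sum>i\<in>UNIV. (w $ i) *s e i)"
proof (rule linearI)
  show "(\<Sum>i\<in>UNIV. ((r *\<^sub>R w) $ i) *s e i) = r *\<^sub>R (\<Sum>i\<in>UNIV. (w $ i) *s e i)" for r and w :: "complex ^ 'n"
    unfolding scaleR_sum_right
    by (intro sum.cong refl) (simp add: vec_eq_iff)
qed (simp add: vector_sadd_rdistrib sum.distrib)

lemma complex_spanning_family:
  fixes S :: "(complex ^ 'n) set"
  assumes "vec.span S = UNIV"
  obtains e :: "'n \<Rightarrow> complex ^ 'n" where "range e \<subseteq> S" "\<And>v. \<exists>w. v = (\<Sum>i\<in>UNIV. w i *s e i)"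
proof -
  obtain B where B: "B \<subseteq> S" "vec.independent B" "S \<subseteq> vec.span B"
    using vec.maximal_independent_subset by blast
  have span: "vec.span B = UNIV"
    using vec.span_minimal[OF B(3) vec.subspace_span] assms by auto
  have fin: "finite B" using B(2) by (rule vec.finiteI_independent)
  have "card B = CARD('n)"
    using vec.dim_eq_card[of B UNIV] span B(2) by (simp add: vec.span_UNIV vec_dim_card card_cart_basis)
  then obtain e :: "'n \<Rightarrow> complex ^ 'n" where e: "bij_betw e UNIV B"
    using fin finite_same_card_bij[of "UNIV :: 'n set" B] by auto
  show thesis
  proof
    show "range e \<subseteq> S" using e B(1) by (simp add: bij_betw_def)
    show "\<exists>w. v = (\<Sum>i\<in>UNIV. w i *s e i)" for v
    proof -
      obtain u where "v = (\<Sum>b\<in>B. u b *s b)"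
        using span vec.span_finite[OF fin] by (metis (no_types, lifting) UNIV_I imageE)
      also have "\<dots> = (\<Sum>i\<in>UNIV. u (e i) *s e i)"
        by (rule sum.reindex_bij_betw[OF e, symmetric])
      finally show ?thesis by (intro exI[of _ "\<lambda>i. u (e i)"])
    qed
  qed
qed

lemma complex_basis_bounded_below:
  fixes e :: "'n \<Rightarrow> complex ^ 'n"
  assumes "\<And>v. \<exists>w. v = (\<Sum>i\<in>UNIV. w i *s e i)"
  obtains \<beta> where "\<beta> > 0" "\<And>w i. \<beta> * cmod (w i) \<le> norm (\<Sum>i\<in>UNIV. w i *s e i)"
proof -
  let ?T = "\<lambda>w :: complex ^ 'n. \<Sum>i\<in>UNIV. (w $ i) *s e i"
  have "surj ?T"
  proof (rule surjI)
    fix v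
    show "?T (\<chi> i. (SOME w. v = (\<Sum>i\<in>UNIV. w i *s e i)) i) = v"
      using someI_ex[OF assms[of v]] by simp
  qed
  then have "inj ?T"
    by (rule linear_surjective_imp_injective[OF linear_complex_combination]) (rule refl)
  then obtain \<beta> where \<beta>: "\<beta> > 0" "\<And>w. \<beta> * norm w \<le> norm (?T w)"
    using linear_inj_bounded_below_pos[OF linear_complex_combination] by blast
  show thesis
  proof
    show "\<beta> > 0" by (rule \<beta>)
    fix w :: "'n \<Rightarrow> complex" and i
    have "\<beta> * cmod (w i) \<le> \<beta> * norm (\<chi> i. w i)"
      using \<beta>(1) Finite_Cartesian_Product.norm_nth_le[where x = "\<chi> i. w i" and i = i] by simp
    also have "\<dots> \<le> norm (\<Sum>i\<in>UNIV. w i *s e i)" using \<beta>(2)[of "\<chi> i. w i"] by simp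
    finally show "\<beta> * cmod (w i) \<le> norm (\<Sum>i\<in>UNIV. w i *s e i)" .
  qed
qed

text \<open>
  The lower bound for the map from coordinates to vectors survives the perturbation with half its
  constant, so the perturbed map is injective, and hence surjective by equality of dimensions.
\<close>

lemma complex_basis_perturbation:
  fixes d e :: "'n \<Rightarrow> complex ^ 'n"
  assumes \<beta>: "\<beta> > 0" "\<And>w i. \<beta> * cmod (w i) \<le> norm (\<Sum>i\<in>UNIV. w i *s e i)"
    and d: "\<And>i. norm (d i - e i) \<le> \<beta> / (2 * CARD('n))"
  shows "\<exists>w. v = (\<Sum>i\<in>UNIV. w i *s d i) \<and> (\<forall>i. cmod (w i) \<le> 2 / \<beta> * norm v)"
proof -
  have below: "\<beta> / 2 * cmod (w i) \<le> norm (\<Sum>i\<in>UNIV. w i *s d i)" for w :: "'n \<Rightarrow> complex" and i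
  proof -
    obtain j where j: "\<And>i. cmod (w i) \<le> cmod (w j)"
      using Max_in[of "range (\<lambda>i. cmod (w i))"] Max_ge[of "range (\<lambda>i. cmod (w i))"] by fastforce
    have "norm ((\<Sum>i\<in>UNIV. w i *s d i) - (\<Sum>i\<in>UNIV. w i *s e i))
        = norm (\<Sum>i\<in>UNIV. w i *s (d i - e i))"
      by (simp add: sum_subtractf vector_ssub_ldistrib)
    also have "\<dots> \<le> (\<Sum>i\<in>(UNIV :: 'n set). cmod (w j) * (\<beta> / (2 * CARD('n))))"
    proof (rule sum_norm_le)
      show "norm (w i *s (d i - e i)) \<le> cmod (w j) * (\<beta> / (2 * CARD('n)))" for i
        unfolding norm_vector_scalar_mult by (rule mult_mono[OF j d]) auto
    qed
    also have "\<dots> = \<beta> / 2 * cmod (w j)" by simp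
    finally have "norm ((\<Sum>i\<in>UNIV. w i *s d i) - (\<Sum>i\<in>UNIV. w i *s e i)) \<le> \<beta> / 2 * cmod (w j)" .
    moreover have "\<beta> * cmod (w j) \<le> norm (\<Sum>i\<in>UNIV. w i *s e i)" by (rule \<beta>(2))
    ultimately have "\<beta> / 2 * cmod (w j) \<le> norm (\<Sum>i\<in>UNIV. w i *s d i)"
      using norm_triangle_sub[of "\<Sum>i\<in>UNIV. w i *s e i" "\<Sum>i\<in>UNIV. w i *s d i"]
      by (simp add: norm_minus_commute)
    moreover have "\<beta> / 2 * cmod (w i) \<le> \<beta> / 2 * cmod (w j)" using j \<beta>(1) by simp
    ultimately show ?thesis by linarith
  qed
  let ?T = "\<lambda>w :: complex ^ 'n. \<Sum>i\<in>UNIV. (w $ i) *s d i"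
  have "inj ?T"
    unfolding linear_injective_0[OF linear_complex_combination]
  proof (intro allI impI)
    fix w :: "complex ^ 'n" assume "?T w = 0"
    then have "\<beta> / 2 * cmod (w $ i) \<le> 0" for i using below[of "\<lambda>i. w $ i" i] by simp
    then have "w $ i = 0" for i using \<beta>(1) by (simp add: mult_le_0_iff)
    then show "w = 0" by (simp add: vec_eq_iff)
  qed
  then have "surj ?T"
    by (rule linear_injective_imp_surjective[OF linear_complex_combination]) (rule refl)
  then obtain w where w: "v = ?T w" unfolding surj_def by blast
  have "cmod (w $ i) \<le> 2 / \<beta> * norm v" for i
    using below[of "\<lambda>i. w $ i" i] \<beta>(1) unfolding w by (simp add: field_simps)
  then show ?thesis using w by (intro exI[of _ "\<lambda>i. w $ i"]) simp
qed

lemma complex_span_of_generic_image: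
  fixes g :: "complex ^ 'n \<Rightarrow> complex ^ 'n"
  assumes g: "linear g" and E: "g ` span S + complex_structure ` g ` span S = UNIV"
  shows "vec.span (g ` S) = UNIV"
proof -
  have "g ` span S = span (g ` S)" by (rule linear_span_image[OF g, symmetric])
  also have "\<dots> \<subseteq> vec.span (g ` S)"
  proof (rule span_minimal)
    show "subspace (vec.span (g ` S))"
      unfolding subspace_def
      by (auto simp: vec.span_zero vec.span_add vec.span_scale simp flip: of_real_vector_scalar_mult)
  qed (auto simp: vec.span_base)
  finally have sub: "g ` span S \<subseteq> vec.span (g ` S)" .
  have "v \<in> vec.span (g ` S)" for v
  proof -
    have "v \<in> g ` span S + complex_structure ` g ` span S" using E by simp
    then obtain a b where "a \<in> g ` span S" "b \<in> g ` span S" "v = a + complex_structure b"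
      by (auto elim!: set_plus_elim)
    then show ?thesis
      using sub by (auto simp: complex_structure_def intro!: vec.span_add vec.span_scale)
  qed
  then show ?thesis by auto
qed

section \<open>Corners in piecewise smooth generic submanifolds\<close>

text \<open>
  For every point \<open>y\<^sub>0\<close> of \<open>P\<close> near \<open>\<Psi> p\<close>, the simplex with apex \<open>y\<^sub>0\<close> and edges towards fixed points
  \<open>c i\<close> of \<open>P\<close> lies in \<open>P\<close>, so its image under the inverse chart is a corner in \<open>K\<close>. Genericity
  permits a choice of the \<open>c i\<close> for which the edges at \<open>\<Psi> p\<close> become a complex basis, and since the
  derivative is continuous, one set of constants serves all apexes close to \<open>\<Psi> p\<close>.
\<close>

lemma tube_bounded_near_polyhedron:
  fixes K :: "(complex ^ 'n) set" and \<Psi> :: "complex ^ 'n \<Rightarrow> complex ^ 'n"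
  assumes gen: "CR_generic (Suc (Suc k)) m K" and p: "p \<in> K"
    and chart: "unit_ball_chart_at (Suc (Suc k)) p W \<Psi>"
    and F: "finite F" "\<And>P. P \<in> F \<Longrightarrow> polyhedron P \<and> aff_dim P = int m"
    and image: "\<Psi> ` (K \<inter> W) = ball 0 1 \<inter> \<Union>F"
    and P: "P \<in> F" "\<Psi> p \<in> P" and r: "r > 0"
  shows "\<exists>\<rho>>0. \<exists>c>0. \<forall>y\<in>P \<inter> ball (\<Psi> p) \<rho>. tube_bounded K r c (inv_into W \<Psi> y)"
proof -
  define \<Phi> where "\<Phi> = inv_into W \<Psi>"
  define G where "G y = frechet_derivative \<Phi> (at y)" for y
  define y where "y = \<Psi> p"
  define n where "n = real CARD('n)"
  have n: "n \<ge> 1" unfolding n_def using zero_less_card_finite[where 'a = 'n] by linarith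
  have diffeo: "Ck_diffeomorphism (Suc (Suc k)) W (ball 0 1) \<Psi>" and pW: "p \<in> W"
    using chart unfolding unit_ball_chart_at_def by auto
  have \<Phi>: "Ck_on (Suc (Suc k)) (ball 0 1) \<Phi>" using diffeo unfolding Ck_diffeomorphism_def \<Phi>_def by simp
  have \<Phi>': "(\<Phi> has_derivative G x) (at x)" if "x \<in> ball 0 1" for x
    unfolding G_def by (rule Ck_on_imp_differentiable[OF \<Phi> that])
  have linG: "linear (G x)" if "x \<in> ball 0 1" for x
    using \<Phi>'[OF that] by (rule has_derivative_linear)
  have y: "y \<in> ball 0 1" "y \<in> P"
    using image p pW P(2) unfolding y_def by auto
  have \<Phi>y: "\<Phi> y = p" unfolding \<Phi>_def y_def by (rule Ck_diffeomorphism_inverse(3)[OF diffeo pW])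
  have in_K: "\<Phi> x \<in> K" if "x \<in> P" "x \<in> ball 0 1" for x
  proof -
    have "x \<in> \<Psi> ` (K \<inter> W)" unfolding image using that P(1) by auto
    then show ?thesis using Ck_diffeomorphism_inverse(3)[OF diffeo] by (auto simp: \<Phi>_def)
  qed
  have "convex P" using F(2)[OF P(1)] by (simp add: polyhedron_imp_convex)
  have "G y ` span ((\<lambda>x. - y + x) ` P) + complex_structure ` G y ` span ((\<lambda>x. - y + x) ` P) = UNIV"
    unfolding G_def \<Phi>_def y_def by (rule generic_directions_of_polyhedron[OF gen p chart F image P])
  then have "vec.span (G y ` (\<lambda>x. - y + x) ` P) = UNIV"
    by (rule complex_span_of_generic_image[OF linG[OF y(1)]])
  then obtain e :: "'n \<Rightarrow> complex ^ 'n" where e: "range e \<subseteq> G y ` (\<lambda>x. - y + x) ` P"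
    "\<And>v. \<exists>w. v = (\<Sum>i\<in>UNIV. w i *s e i)"
    by (rule complex_spanning_family) (rule that)
  have "\<exists>c. c \<in> P \<and> e i = G y (c - y)" for i
  proof -
    have "e i \<in> G y ` (\<lambda>x. - y + x) ` P" using e(1) by blast
    then show ?thesis by auto
  qed
  then obtain c where c: "\<And>i. c i \<in> P" "\<And>i. e i = G y (c i - y)" by metis
  obtain \<beta> where \<beta>: "\<beta> > 0" "\<And>w i. \<beta> * cmod (w i) \<le> norm (\<Sum>i\<in>UNIV. w i *s e i)"
    using complex_basis_bounded_below[OF e(2)] by blast
  obtain R0 where R0: "R0 > 0" "cball y R0 \<subseteq> ball 0 1"
    using y(1) open_contains_cball[of "ball 0 1 :: (complex ^ 'n) set"] by (meson open_ball)
  obtain L where L: "L > 0"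
    "\<And>x z v. x \<in> cball y R0 \<Longrightarrow> z \<in> cball y R0 \<Longrightarrow> norm (G z v - G x v) \<le> L * norm (z - x) * norm v"
    unfolding G_def using C2_derivative_Lipschitz[OF \<Phi> R0(2)] by blast
  obtain g where g: "g > 0" "\<And>v. norm (G y v) \<le> g * norm v"
    using linear_bounded_pos[OF linG[OF y(1)]] by blast
  define C where "C = 1 + (\<Sum>i\<in>UNIV. norm (c i - y))"
  have C: "C \<ge> 1" by (simp add: C_def sum_nonneg)
  have "isCont \<Phi> y" using \<Phi>'[OF y(1)] by (rule has_derivative_continuous)
  then obtain R1 where R1: "R1 > 0" "\<And>x. dist x y < R1 \<Longrightarrow> dist (\<Phi> x) p < r / 2"
    unfolding continuous_at_eps_delta using r \<Phi>y by (metis half_gt_zero)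
  \<comment> \<open>At this distance the chart is defined, stays within \<open>r / 2\<close> of \<open>p\<close>, and moves the edge vectors so
    little that they remain a basis.\<close>
  define R where "R = min (min R0 1) (min (R1 / 2) (\<beta> / (2 * n) / (L * C + g)))"
  have LCg: "L * C + g > 0" using L C g by (intro add_pos_pos mult_pos_pos) auto
  have R: "R > 0" "R \<le> R0" "R \<le> 1" "R < R1"
    using R0 R1 \<beta>(1) n LCg unfolding R_def by (auto simp: min_less_iff_disj)
  have "R \<le> \<beta> / (2 * n) / (L * C + g)" unfolding R_def by simp
  then have R\<beta>: "R * (L * C + g) \<le> \<beta> / (2 * n)" by (simp only: pos_le_divide_eq[OF LCg])
  \<comment> \<open>So small that the cube moves points by at most \<open>R / 2\<close> and that \<open>n * t i \<le> 1\<close>.\<close>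
  define a where "a = R / (2 * n * C)"
  have nC: "n * C \<ge> 1" using n C mult_mono[of 1 n 1 C] by simp
  have a: "a > 0" using R n C by (simp add: a_def)
  have anC: "a * (n * C) = R / 2" using n C by (simp add: a_def)
  have "a * n \<le> a * (n * C)" using a n C by simp
  then have an: "a * n \<le> 1" using anC R by linarith
  have corner: "tube_bounded K r (8 * (L * (n * C)\<^sup>2) *
      (min a (1 / (512 * (L * (n * C)\<^sup>2) * (2 / \<beta>) * (real CARD('n))\<^sup>2)))\<^sup>2) (\<Phi> y0)"
    if y0: "y0 \<in> P" "y0 \<in> ball y (R / 2)" for y0
  proof -
    define Y where "Y t = y0 + (\<Sum>i\<in>UNIV. t i *\<^sub>R (c i - y0))" for t :: "'n \<Rightarrow> real"
    define h where "h t = \<Phi> (Y t)" for t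
    define d where "d t i = G (Y t) (c i - y0)" for t i
    have Y0: "Y (\<lambda>_. 0) = y0" by (simp add: Y_def)
    have y0d: "norm (y0 - y) < R / 2" using y0 by (simp add: dist_norm norm_minus_commute)
    have cC: "norm (c i - y0) \<le> C" for i
    proof -
      have "norm (c i - y) \<le> (\<Sum>i\<in>UNIV. norm (c i - y))" by (rule member_le_sum) auto
      then show ?thesis
        using norm_triangle_ineq4[of "c i - y" "y0 - y"] y0d R(3) by (simp add: C_def)
    qed
    have edges: "norm (\<Sum>i\<in>UNIV. u i *\<^sub>R (c i - y0)) \<le> n * C * \<sigma>" if "u \<in> parameter_cube \<sigma>" for u \<sigma>
    proof -
      have "norm (\<Sum>i\<in>UNIV. u i *\<^sub>R (c i - y0)) \<le> (\<Sum>i\<in>(UNIV :: 'n set). \<sigma> * C)"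
        by (rule sum_norm_le) (use that cC in \<open>auto simp: parameter_cube_def intro!: mult_mono intro: order_trans\<close>)
      then show ?thesis by (simp add: n_def mult_ac)
    qed
    have YR: "norm (Y t - y) \<le> R" if "t \<in> parameter_cube a" for t
      using edges[OF that] anC y0d norm_triangle_ineq[of "y0 - y" "\<Sum>i\<in>UNIV. t i *\<^sub>R (c i - y0)"]
      by (simp add: Y_def algebra_simps)
    then have Yball: "Y t \<in> cball y R0" if "t \<in> parameter_cube a" for t
      using that R(2) by (force simp: dist_norm norm_minus_commute)
    have YP: "Y t \<in> P" if t: "t \<in> parameter_cube a" for t
    proof -
      \<comment> \<open>\<open>Y t\<close> is the average of the points \<open>y0 + n * t i *\<^sub>R (c i - y0)\<close> of the segments from \<open>y0\<close> to \<open>c i\<close>.\<close>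
      have "(\<Sum>i\<in>UNIV. (1 / n) *\<^sub>R ((1 - n * t i) *\<^sub>R y0 + (n * t i) *\<^sub>R c i)) \<in> P"
      proof (rule convex_sum)
        show "(\<Sum>i\<in>(UNIV :: 'n set). 1 / n) = 1" by (simp add: n_def)
        show "(1 - n * t i) *\<^sub>R y0 + (n * t i) *\<^sub>R c i \<in> P" for i
        proof -
          have "n * t i \<le> n * a" using t n by (simp add: parameter_cube_def)
          then have "n * t i \<le> 1" using an by (simp add: mult.commute)
          moreover have "0 \<le> n * t i" using t n by (simp add: parameter_cube_def)
          ultimately show ?thesis using \<open>convex P\<close> y0(1) c(1) by (intro convexD) auto
        qed
      qed (use \<open>convex P\<close> n in auto)
      also have "(\<Sum>i\<in>UNIV. (1 / n) *\<^sub>R ((1 - n * t i) *\<^sub>R y0 + (n * t i) *\<^sub>R c i))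
          = (\<Sum>i\<in>(UNIV :: 'n set). (1 / n) *\<^sub>R y0) + (\<Sum>i\<in>UNIV. t i *\<^sub>R (c i - y0))"
        unfolding sum.distrib[symmetric] using n by (intro sum.cong refl) (simp add: algebra_simps)
      also have "(\<Sum>i\<in>(UNIV :: 'n set). (1 / n) *\<^sub>R y0) = y0"
        unfolding sum_constant_scaleR by (simp add: n_def)
      finally show ?thesis by (simp add: Y_def)
    qed
    have "totally_real_corner a (L * (n * C)\<^sup>2) (2 / \<beta>) h d"
      unfolding totally_real_corner_def
    proof (intro conjI ballI allI impI, elim conjE)
      fix t u :: "'n \<Rightarrow> real" and \<sigma>
      assume t: "t \<in> parameter_cube a" and tu: "(\<lambda>i. t i + u i) \<in> parameter_cube a"
        and u: "u \<in> parameter_cube \<sigma>"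
      let ?v = "\<Sum>i\<in>UNIV. u i *\<^sub>R (c i - y0)"
      have Yd: "Y (\<lambda>i. t i + u i) - Y t = ?v"
        by (simp add: Y_def scaleR_add_left sum.distrib)
      have "(\<Sum>i\<in>UNIV. of_real (u i) *s d t i) = G (Y t) ?v"
      proof -
        have "linear (G (Y t))" using Yball[OF t] R0(2) by (intro linG) blast
        then show ?thesis by (simp add: linear_sum linear_scale d_def of_real_vector_scalar_mult)
      qed
      then have "norm (h (\<lambda>i. t i + u i) - (h t + (\<Sum>i\<in>UNIV. of_real (u i) *s d t i)))
          = norm (\<Phi> (Y (\<lambda>i. t i + u i)) - (\<Phi> (Y t) + G (Y t) (Y (\<lambda>i. t i + u i) - Y t)))"
        by (simp add: h_def Yd)
      also have "\<dots> \<le> L * (norm (Y (\<lambda>i. t i + u i) - Y t))\<^sup>2"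
        by (rule quadratic_error_of_Lipschitz_derivative[of "cball y R0"])
           (use \<Phi>' R0(2) L Yball t tu in \<open>auto simp del: mem_cball mem_ball\<close>)
      also have "\<dots> \<le> L * (n * C * \<sigma>)\<^sup>2"
        unfolding Yd using edges[OF u] L(1) by (intro mult_left_mono power_mono) auto
      finally show "norm (h (\<lambda>i. t i + u i) - (h t + (\<Sum>i\<in>UNIV. of_real (u i) *s d t i))) \<le> L * (n * C)\<^sup>2 * \<sigma>\<^sup>2"
        by (simp add: power_mult_distrib mult_ac)
    next
      fix t :: "'n \<Rightarrow> real" and v assume t: "t \<in> parameter_cube a"
      show "\<exists>w. v = (\<Sum>i\<in>UNIV. w i *s d t i) \<and> (\<forall>i. cmod (w i) \<le> 2 / \<beta> * norm v)"
      proof (rule complex_basis_perturbation[OF \<beta>])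
        fix i
        have "d t i - e i = (G (Y t) (c i - y0) - G y (c i - y0)) - G y (y0 - y)"
          by (simp add: d_def c(2) linear_diff[OF linG[OF y(1)]])
        also have "norm \<dots> \<le> norm (G (Y t) (c i - y0) - G y (c i - y0)) + norm (G y (y0 - y))"
          by (rule norm_triangle_ineq4)
        also have "\<dots> \<le> L * R * C + g * R"
        proof (rule add_mono)
          have "norm (G (Y t) (c i - y0) - G y (c i - y0)) \<le> L * norm (Y t - y) * norm (c i - y0)"
            using L(2)[OF _ Yball[OF t]] R0(1) by simp
          also have "\<dots> \<le> L * R * C"
            using YR[OF t] cC L(1) R(1) by (intro mult_mono) auto
          finally show "norm (G (Y t) (c i - y0) - G y (c i - y0)) \<le> L * R * C" .
          have "norm (G y (y0 - y)) \<le> g * norm (y0 - y)" by (rule g(2))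
          also have "\<dots> \<le> g * R" using y0d R(1) g(1) by (intro mult_left_mono) auto
          finally show "norm (G y (y0 - y)) \<le> g * R" .
        qed
        also have "\<dots> \<le> \<beta> / (2 * n)" using R\<beta> by (simp add: algebra_simps)
        finally show "norm (d t i - e i) \<le> \<beta> / (2 * CARD('n))" by (simp add: n_def)
      qed
    qed
    moreover have "h ` parameter_cube a \<subseteq> K \<inter> ball (h (\<lambda>_. 0)) r"
    proof (intro image_subsetI IntI)
      fix t :: "'n \<Rightarrow> real" assume t: "t \<in> parameter_cube a"
      show "h t \<in> K" unfolding h_def using YP[OF t] Yball[OF t] R0(2) by (intro in_K) blast+
      have "dist (Y t) y < R1" using YR[OF t] R(4) by (simp add: dist_norm)
      then have "dist (h t) p < r / 2" unfolding h_def by (rule R1(2))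
      moreover have "dist y0 y < R1" using y0d R by (simp add: dist_norm)
      then have "dist (h (\<lambda>_. 0)) p < r / 2" unfolding h_def Y0 by (rule R1(2))
      ultimately show "h t \<in> ball (h (\<lambda>_. 0)) r"
        unfolding mem_ball using dist_triangle2[of "h (\<lambda>_. 0)" "h t" p] by linarith
    qed
    ultimately have "tube_bounded K r (8 * (L * (n * C)\<^sup>2) *
        (min a (1 / (512 * (L * (n * C)\<^sup>2) * (2 / \<beta>) * (real CARD('n))\<^sup>2)))\<^sup>2) (h (\<lambda>_. 0))"
      using a L(1) n C \<beta>(1) by (intro tube_bounded_of_totally_real_corner) auto
    then show ?thesis by (simp only: h_def Y0)
  qed
  have "8 * (L * (n * C)\<^sup>2) * (min a (1 / (512 * (L * (n * C)\<^sup>2) * (2 / \<beta>) * (real CARD('n))\<^sup>2)))\<^sup>2 > 0"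
    using a L(1) n C \<beta>(1) by (intro mult_pos_pos zero_less_power) auto
  moreover have "R / 2 > 0" using R by simp
  ultimately show ?thesis
    using corner unfolding \<Phi>_def y_def by blast
qed

text \<open>
  Every point of \<open>K\<close> close to \<open>p\<close> lies, in the chart, on one of the finitely many polyhedra, and this
  polyhedron contains \<open>\<Psi> p\<close>, because the others are closed and keep a positive distance.
\<close>

lemma tube_bounded_near_point:
  fixes K :: "(complex ^ 'n) set"
  assumes smooth: "nondegenerate_piecewise_smooth (Suc (Suc k)) m K"
    and gen: "CR_generic (Suc (Suc k)) m K" and p: "p \<in> K" and r: "r > 0"
  shows "\<exists>\<rho>>0. \<exists>c>0. \<forall>z\<in>K \<inter> ball p \<rho>. tube_bounded K r c z"
proof -
  obtain W \<Psi> F where chart: "unit_ball_chart_at (Suc (Suc k)) p W \<Psi>"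
    and F: "finite F" "\<And>P. P \<in> F \<Longrightarrow> polyhedron P \<and> aff_dim P = int m"
    and image: "\<Psi> ` (K \<inter> W) = ball 0 1 \<inter> \<Union>F"
    using smooth p unfolding nondegenerate_piecewise_smooth_def by metis
  have diffeo: "Ck_diffeomorphism (Suc (Suc k)) W (ball 0 1) \<Psi>" and pW: "p \<in> W"
    using chart unfolding unit_ball_chart_at_def by auto
  have "\<exists>\<rho>>0. \<exists>c>0. \<forall>y\<in>P \<inter> ball (\<Psi> p) \<rho>. tube_bounded K r c (inv_into W \<Psi> y)" if P: "P \<in> F" for P
  proof (cases "\<Psi> p \<in> P")
    case True
    show ?thesis using tube_bounded_near_polyhedron[OF gen p chart F image P True r] .
  next
    case False
    have "closed P" using F(2)[OF P] by (simp add: polyhedron_imp_closed)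
    then obtain \<rho> where "\<rho> > 0" "ball (\<Psi> p) \<rho> \<subseteq> - P"
      using False open_contains_ball[of "- P"] by (meson ComplI open_Compl)
    then show ?thesis by (intro exI[of _ \<rho>] conjI exI[of _ "1::real"]) auto
  qed
  then obtain \<rho> c where \<rho>: "\<And>P. P \<in> F \<Longrightarrow> \<rho> P > 0" and c: "\<And>P. P \<in> F \<Longrightarrow> c P > 0"
    and tube: "\<And>P y. P \<in> F \<Longrightarrow> y \<in> P \<Longrightarrow> y \<in> ball (\<Psi> p) (\<rho> P) \<Longrightarrow> tube_bounded K r (c P) (inv_into W \<Psi> y)"
    by (metis IntI)
  define \<rho>m where "\<rho>m = Min (insert 1 (\<rho> ` F))"
  define cm where "cm = Min (insert 1 (c ` F))"
  have pos: "\<rho>m > 0" "cm > 0" using F(1) \<rho> c by (auto simp: \<rho>m_def cm_def)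
  have le: "\<rho>m \<le> \<rho> P" "cm \<le> c P" if "P \<in> F" for P
    using F(1) that by (auto simp: \<rho>m_def cm_def)
  have "open W" "isCont \<Psi> p"
    using diffeo pW Ck_on_imp_continuous_on[of "Suc (Suc k)" W \<Psi>]
    unfolding Ck_diffeomorphism_def by (auto simp: continuous_on_eq_continuous_at)
  then obtain \<delta>1 \<delta>2 where \<delta>: "\<delta>1 > 0" "ball p \<delta>1 \<subseteq> W" "\<delta>2 > 0"
    "\<And>x. dist x p < \<delta>2 \<Longrightarrow> dist (\<Psi> x) (\<Psi> p) < \<rho>m"
    unfolding continuous_at_eps_delta using pos(1) pW by (metis open_contains_ball)
  have "tube_bounded K r cm z" if z: "z \<in> K \<inter> ball p (min \<delta>1 \<delta>2)" for z
  proof -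
    have zW: "z \<in> W" using z \<delta>(2) by auto
    then have "\<Psi> z \<in> ball 0 1 \<inter> \<Union>F" using image z by blast
    then obtain P where P: "P \<in> F" "\<Psi> z \<in> P" by auto
    have "dist (\<Psi> z) (\<Psi> p) < \<rho>m" using z by (intro \<delta>(4)) (simp add: dist_commute)
    then have "\<Psi> z \<in> ball (\<Psi> p) (\<rho> P)" using le(1)[OF P(1)] by (simp add: dist_commute)
    then have "tube_bounded K r (c P) z"
      using tube[OF P] Ck_diffeomorphism_inverse(3)[OF diffeo zW] by simp
    then show ?thesis using le(2)[OF P(1)] by (rule tube_bounded_mono)
  qed
  then show ?thesis using \<delta>(1,3) pos(2) by (intro exI[of _ "min \<delta>1 \<delta>2"] conjI exI[of _ cm]) auto
qed

lemma tube_bounded_uniform: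
  fixes K :: "(complex ^ 'n) set"
  assumes K: "compact K" and smooth: "nondegenerate_piecewise_smooth (Suc (Suc k)) m K"
    and gen: "CR_generic (Suc (Suc k)) m K" and r: "r > 0"
  shows "\<exists>c>0. \<forall>z\<in>K. tube_bounded K r c z"
proof -
  obtain \<rho> c where \<rho>: "\<And>p. p \<in> K \<Longrightarrow> \<rho> p > 0" and c: "\<And>p. p \<in> K \<Longrightarrow> c p > 0"
    and tube: "\<And>p z. p \<in> K \<Longrightarrow> z \<in> K \<Longrightarrow> z \<in> ball p (\<rho> p) \<Longrightarrow> tube_bounded K r (c p) z"
    using tube_bounded_near_point[OF smooth gen _ r] by (metis IntI)
  obtain D where D: "D \<subseteq> K" "finite D" "K \<subseteq> (\<Union>p\<in>D. ball p (\<rho> p))"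
  proof (rule compactE_image[OF K, of K "\<lambda>p. ball p (\<rho> p)"])
    show "K \<subseteq> (\<Union>p\<in>K. ball p (\<rho> p))" using \<rho> by force
  qed auto
  define cm where "cm = Min (insert 1 (c ` D))"
  have "cm > 0" using D c by (auto simp: cm_def)
  moreover have "tube_bounded K r cm z" if z: "z \<in> K" for z
  proof -
    obtain p where p: "p \<in> D" "z \<in> ball p (\<rho> p)" using D(3) z by auto
    have "cm \<le> c p" using D(2) p(1) by (simp add: cm_def)
    with tube[OF _ z p(2)] D(1) p(1) show ?thesis by (blast intro: tube_bounded_mono)
  qed
  ultimately show ?thesis by blast
qed

theorem theorem1p3:
  fixes K :: "(complex ^ 'n) set" and m :: nat
    and \<mu> :: "(complex ^ 'n) measure" and \<tau> r\<^sub>0 :: real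
  assumes "compact K"
    and "nondegenerate_piecewise_smooth 5 m K"
    and "CR_generic 5 m K"
    and "sets \<mu> = sets borel"
    and "finite_measure \<mu>"
    and "emeasure \<mu> (- K) = 0"
    and "\<tau> > 0"
    and "r\<^sub>0 > 0"
    and "\<forall>z\<in>K. \<forall>r. 0 < r \<and> r \<le> r\<^sub>0 \<longrightarrow> measure \<mu> (ball z r \<inter> K) \<ge> r powr \<tau>"
  shows "\<forall>Q :: complex ^ 'n \<Rightarrow> real. continuous_on K Q \<longrightarrow> bernstein_markov \<mu> K Q"
proof (intro allI impI)
  fix Q :: "complex ^ 'n \<Rightarrow> real" assume Q: "continuous_on K Q"
  have tube: "\<exists>c>0. \<forall>z\<in>K. tube_bounded K r c z" if "r > 0" for r
    by (rule tube_bounded_uniform[where k = 3]) (use assms(1-3) that in \<open>auto simp: eval_nat_numeral\<close>)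
  show "bernstein_markov \<mu> K Q"
    by (rule bernstein_markov_of_uniform_tube_bound[OF assms(1,4,5,7,8) _ tube Q])
       (use assms(9) in blast)
qed

end
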